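(* Let $I$ be a closed ideal of the Banach lattice $E$. If $I$ has the weak Dunford-Pettis property and $E/I$ has the positive Schur property, then $E$ has the weak Dunford-Pettis property.
   Context: A Banach lattice $E$ has the weak Dunford-Pettis property if every weakly compact operator on $E$ (i.e. from $E$ into an arbitrary Banach space) sends weakly null sequences formed by pairwise disjoint vectors to norm null sequences. A Banach lattice has the positive Schur property if every weakly null sequence formed by positive vectors is norm null. The quotient $E/I$ is a Banach lattice with the quotient norm and the quotient order ($\dot x\le\dot y$ if there are $x_1\in\dot x$, $y_1\in\dot y$ with $x_1\le y_1$). *)

theory Defs
  imports "HOL-Analysis.Analysis" "HOL-Library.Lattice_Algebras"
begin

class banach_lattice = banach + ordered_real_vector + lattice_ab_group_add_abs +
  assumes norm_mono_abs: "\<bar>x\<bar> \<le> \<bar>y\<bar> \<Longrightarrow> norm x \<le> norm y"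

definition closed_ideal :: "'a::banach_lattice set \<Rightarrow> bool" where
  "closed_ideal I \<longleftrightarrow>
     subspace I \<and> closed I \<and> (\<forall>x y. y \<in> I \<and> \<bar>x\<bar> \<le> \<bar>y\<bar> \<longrightarrow> x \<in> I)"

(* The spaces E, I, E/I and the codomains of operators are all treated as structures with an
   explicit carrier, so that each Banach space notion is defined once and applies to all of them. *)

record 'a normed_struct =
  vcarrier :: "'a set"
  vadd :: "'a \<Rightarrow> 'a \<Rightarrow> 'a"
  vzero :: 'a
  vscale :: "real \<Rightarrow> 'a \<Rightarrow> 'a"
  vnorm :: "'a \<Rightarrow> real"

record 'a normed_lattice_struct = "'a normed_struct" +
  vle :: "'a \<Rightarrow> 'a \<Rightarrow> bool"

definition banach_space :: "('a, 'm) normed_struct_scheme \<Rightarrow> bool" where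
  "banach_space V \<longleftrightarrow>
     vzero V \<in> vcarrier V \<and>
     (\<forall>x\<in>vcarrier V. \<forall>y\<in>vcarrier V. vadd V x y \<in> vcarrier V) \<and>
     (\<forall>c. \<forall>x\<in>vcarrier V. vscale V c x \<in> vcarrier V) \<and>
     (\<forall>x\<in>vcarrier V. \<forall>y\<in>vcarrier V. \<forall>z\<in>vcarrier V.
        vadd V (vadd V x y) z = vadd V x (vadd V y z)) \<and>
     (\<forall>x\<in>vcarrier V. \<forall>y\<in>vcarrier V. vadd V x y = vadd V y x) \<and>
     (\<forall>x\<in>vcarrier V. vadd V (vzero V) x = x) \<and>
     (\<forall>x\<in>vcarrier V. vadd V x (vscale V (-1) x) = vzero V) \<and>
     (\<forall>c. \<forall>x\<in>vcarrier V. \<forall>y\<in>vcarrier V.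
        vscale V c (vadd V x y) = vadd V (vscale V c x) (vscale V c y)) \<and>
     (\<forall>c d. \<forall>x\<in>vcarrier V. vscale V (c + d) x = vadd V (vscale V c x) (vscale V d x)) \<and>
     (\<forall>c d. \<forall>x\<in>vcarrier V. vscale V c (vscale V d x) = vscale V (c * d) x) \<and>
     (\<forall>x\<in>vcarrier V. vscale V 1 x = x) \<and>
     (\<forall>x\<in>vcarrier V. 0 \<le> vnorm V x) \<and>
     (\<forall>x\<in>vcarrier V. vnorm V x = 0 \<longleftrightarrow> x = vzero V) \<and>
     (\<forall>c. \<forall>x\<in>vcarrier V. vnorm V (vscale V c x) = \<bar>c\<bar> * vnorm V x) \<and>
     (\<forall>x\<in>vcarrier V. \<forall>y\<in>vcarrier V. vnorm V (vadd V x y) \<le> vnorm V x + vnorm V y) \<and>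
     Metric_space.mcomplete (vcarrier V) (\<lambda>x y. vnorm V (vadd V x (vscale V (-1) y)))"

definition bounded_linear_map ::
  "('a, 'm) normed_struct_scheme \<Rightarrow> ('b, 'n) normed_struct_scheme \<Rightarrow> ('a \<Rightarrow> 'b) \<Rightarrow> bool" where
  "bounded_linear_map V W T \<longleftrightarrow>
     (\<forall>x\<in>vcarrier V. T x \<in> vcarrier W) \<and>
     (\<forall>x\<in>vcarrier V. \<forall>y\<in>vcarrier V. T (vadd V x y) = vadd W (T x) (T y)) \<and>
     (\<forall>c. \<forall>x\<in>vcarrier V. T (vscale V c x) = vscale W c (T x)) \<and>
     (\<exists>C. \<forall>x\<in>vcarrier V. vnorm W (T x) \<le> C * vnorm V x)"

definition real_line :: "real normed_struct" where
  "real_line = \<lparr>vcarrier = UNIV, vadd = (+), vzero = 0, vscale = (*), vnorm = abs\<rparr>"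

definition weak_topology :: "('a, 'm) normed_struct_scheme \<Rightarrow> 'a topology" where
  "weak_topology V = topology_generated_by
     {{x \<in> vcarrier V. f x \<in> U} | f U. bounded_linear_map V real_line f \<and> open U}"

definition weakly_null :: "('a, 'm) normed_struct_scheme \<Rightarrow> (nat \<Rightarrow> 'a) \<Rightarrow> bool" where
  "weakly_null V x \<longleftrightarrow>
     range x \<subseteq> vcarrier V \<and> limitin (weak_topology V) x (vzero V) sequentially"

definition norm_null :: "('a, 'm) normed_struct_scheme \<Rightarrow> (nat \<Rightarrow> 'a) \<Rightarrow> bool" where
  "norm_null V x \<longleftrightarrow> range x \<subseteq> vcarrier V \<and> (\<lambda>n. vnorm V (x n)) \<longlonglongrightarrow> 0"

definition weakly_compact_operator ::
  "('a, 'm) normed_struct_scheme \<Rightarrow> ('b, 'n) normed_struct_scheme \<Rightarrow> ('a \<Rightarrow> 'b) \<Rightarrow> bool" where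
  "weakly_compact_operator V W T \<longleftrightarrow>
     bounded_linear_map V W T \<and>
     compactin (weak_topology W)
       (weak_topology W closure_of (T ` {x \<in> vcarrier V. vnorm V x \<le> 1}))"

definition is_vsup :: "('a, 'm) normed_lattice_struct_scheme \<Rightarrow> 'a \<Rightarrow> 'a \<Rightarrow> 'a \<Rightarrow> bool" where
  "is_vsup L x y s \<longleftrightarrow> s \<in> vcarrier L \<and> vle L x s \<and> vle L y s \<and>
     (\<forall>t\<in>vcarrier L. vle L x t \<and> vle L y t \<longrightarrow> vle L s t)"

definition is_vinf :: "('a, 'm) normed_lattice_struct_scheme \<Rightarrow> 'a \<Rightarrow> 'a \<Rightarrow> 'a \<Rightarrow> bool" where
  "is_vinf L x y s \<longleftrightarrow> s \<in> vcarrier L \<and> vle L s x \<and> vle L s y \<and>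
     (\<forall>t\<in>vcarrier L. vle L t x \<and> vle L t y \<longrightarrow> vle L t s)"

definition vabs :: "('a, 'm) normed_lattice_struct_scheme \<Rightarrow> 'a \<Rightarrow> 'a" where
  "vabs L x = (THE s. is_vsup L x (vscale L (-1) x) s)"

definition disjoint_vectors :: "('a, 'm) normed_lattice_struct_scheme \<Rightarrow> 'a \<Rightarrow> 'a \<Rightarrow> bool" where
  "disjoint_vectors L x y \<longleftrightarrow> is_vinf L (vabs L x) (vabs L y) (vzero L)"

(* HOL cannot quantify over all Banach spaces inside a formula.  The first argument names a type
   'f, and the codomain ranges over all Banach spaces whose carrier is a subset of 'f.
   For L with carrier in 'a, the type nat => 'a loses no codomain: a bounded operator T on L may be
   corestricted to the norm closure of its range, every point of which is the limit of T (s n)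
   for some sequence s in L, so this closed subspace has a copy with carrier in nat => 'a. *)
definition weak_dunford_pettis ::
  "'f itself \<Rightarrow> ('a, 'm) normed_lattice_struct_scheme \<Rightarrow> bool" where
  "weak_dunford_pettis TYPE_f L \<longleftrightarrow>
     (\<forall>(F :: 'f normed_struct) T x.
        banach_space F \<and> weakly_compact_operator L F T \<and>
        weakly_null L x \<and> (\<forall>m n. m \<noteq> n \<longrightarrow> disjoint_vectors L (x m) (x n)) \<longrightarrow>
        norm_null F (\<lambda>n. T (x n)))"

definition positive_schur :: "('a, 'm) normed_lattice_struct_scheme \<Rightarrow> bool" where
  "positive_schur L \<longleftrightarrow>
     (\<forall>x. weakly_null L x \<and> (\<forall>n. vle L (vzero L) (x n)) \<longrightarrow> norm_null L x)"

definition sublattice :: "'a::banach_lattice set \<Rightarrow> 'a normed_lattice_struct" where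
  "sublattice S =
     \<lparr>vcarrier = S, vadd = (+), vzero = 0, vscale = (*\<^sub>R), vnorm = norm, vle = (\<le>)\<rparr>"

(* In vscale, adding I makes the result a full coset also for c = 0. *)
definition quotient_lattice :: "'a::banach_lattice set \<Rightarrow> 'a set normed_lattice_struct" where
  "quotient_lattice I =
     \<lparr>vcarrier = range (\<lambda>x. {x + y | y. y \<in> I}),
      vadd = (\<lambda>A B. {a + b | a b. a \<in> A \<and> b \<in> B}),
      vzero = I,
      vscale = (\<lambda>c A. {c *\<^sub>R a + y | a y. a \<in> A \<and> y \<in> I}),
      vnorm = (\<lambda>A. INF a\<in>A. norm a),
      vle = (\<lambda>A B. \<exists>a\<in>A. \<exists>b\<in>B. a \<le> b)\<rparr>"

end

theory Submission
  imports Defs "HOL-Probability.Discrete_Topology"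
begin

text \<open>Let \<open>T\<close> be weakly compact on \<open>E\<close> and let \<open>x\<close> be a disjoint weakly null sequence.  Disjointness makes
  \<open>\<bar>x n\<bar>\<close> weakly null as well: a positive functional \<open>p\<close> can be modified to a functional \<open>g\<close> with
  \<open>g (x n) = p (pprt (x n))\<close> for all \<open>n\<close>.  So the classes of \<open>\<bar>x n\<bar>\<close> are norm null in \<open>E/I\<close>, which
  gives \<open>y n\<close> in \<open>I\<close> with \<open>\<bar>y n\<bar> \<le> \<bar>x n\<bar>\<close> and \<open>x n - y n \<rightarrow> 0\<close>.  The sequence \<open>y\<close> is disjoint,
  and weakly null in \<open>I\<close> because functionals on an ideal are dominated by positive functionals on
  the whole lattice.  Composing the restriction of \<open>T\<close> to \<open>I\<close> with an operator into a space of
  bounded sequences that is norming on \<open>T (y n)\<close> yields \<open>T (y n) \<rightarrow> 0\<close>, hence \<open>T (x n) \<rightarrow> 0\<close>.\<close>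

section \<open>Functionals and the weak topology\<close>

locale banach_struct =
  fixes V :: "('a, 'm) normed_struct_scheme"
  assumes banach_space: "banach_space V"
begin

abbreviation car where "car \<equiv> vcarrier V"
abbreviation add (infixl "\<oplus>" 65) where "add \<equiv> vadd V"
abbreviation scale (infixr "\<odot>" 75) where "scale \<equiv> vscale V"
abbreviation null ("\<zero>") where "null \<equiv> vzero V"
abbreviation nrm where "nrm \<equiv> vnorm V"

lemma zero_closed [simp]: "\<zero> \<in> car"
  and add_closed [simp]: "x \<in> car \<Longrightarrow> y \<in> car \<Longrightarrow> x \<oplus> y \<in> car"
  and scale_closed [simp]: "x \<in> car \<Longrightarrow> c \<odot> x \<in> car"
  and add_assoc: "x \<in> car \<Longrightarrow> y \<in> car \<Longrightarrow> z \<in> car \<Longrightarrow> (x \<oplus> y) \<oplus> z = x \<oplus> (y \<oplus> z)"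
  and add_comm: "x \<in> car \<Longrightarrow> y \<in> car \<Longrightarrow> x \<oplus> y = y \<oplus> x"
  and add_zero_left [simp]: "x \<in> car \<Longrightarrow> \<zero> \<oplus> x = x"
  and add_minus [simp]: "x \<in> car \<Longrightarrow> x \<oplus> (-1) \<odot> x = \<zero>"
  and scale_add: "x \<in> car \<Longrightarrow> y \<in> car \<Longrightarrow> c \<odot> (x \<oplus> y) = c \<odot> x \<oplus> c \<odot> y"
  and add_scale: "x \<in> car \<Longrightarrow> (c + d) \<odot> x = c \<odot> x \<oplus> d \<odot> x"
  and scale_scale [simp]: "x \<in> car \<Longrightarrow> c \<odot> d \<odot> x = (c * d) \<odot> x"
  and scale_one [simp]: "x \<in> car \<Longrightarrow> 1 \<odot> x = x"
  and norm_nonneg [simp]: "x \<in> car \<Longrightarrow> 0 \<le> nrm x"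
  and norm_scale [simp]: "x \<in> car \<Longrightarrow> nrm (c \<odot> x) = \<bar>c\<bar> * nrm x"
  and norm_triangle: "x \<in> car \<Longrightarrow> y \<in> car \<Longrightarrow> nrm (x \<oplus> y) \<le> nrm x + nrm y"
  by (insert banach_space[unfolded banach_space_def], meson+)

lemma norm_eq_zero: "x \<in> car \<Longrightarrow> nrm x = 0 \<longleftrightarrow> x = \<zero>"
  using banach_space unfolding banach_space_def by simp

lemma add_zero_right [simp]: "x \<in> car \<Longrightarrow> x \<oplus> \<zero> = x"
  by (simp add: add_comm[of x])

lemma scale_zero_left [simp]: "x \<in> car \<Longrightarrow> 0 \<odot> x = \<zero>"
  using add_scale[of x 1 "-1"] by simp

lemma scale_zero_right [simp]: "c \<odot> \<zero> = \<zero>"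
  using scale_scale[of \<zero> c 0] by simp

lemma add_minus_cancel: "x \<in> car \<Longrightarrow> y \<in> car \<Longrightarrow> (x \<oplus> y) \<oplus> (-1) \<odot> x = y"
  by (simp add: add_comm[of x y] add_assoc)

lemma eq_of_diff_eq_zero:
  assumes "x \<in> car" "y \<in> car" "x \<oplus> (-1) \<odot> y = \<zero>"
  shows "x = y"
proof -
  have "(x \<oplus> (-1) \<odot> y) \<oplus> y = x"
    using assms(1,2) by (simp add: add_assoc add_comm[of "(-1) \<odot> y" y])
  then show ?thesis using assms by simp
qed

lemma add_swap:
  assumes "x \<in> car" "y \<in> car" "z \<in> car" "w \<in> car"
  shows "(x \<oplus> y) \<oplus> (z \<oplus> w) = (x \<oplus> z) \<oplus> (y \<oplus> w)"
  using assms by (metis add_assoc add_closed add_comm)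

section \<open>Sublinear functionals and the Hahn-Banach theorem\<close>

text \<open>Homogeneity is asked only as an inequality, which passes easily to infima; for
  \<open>c > 0\<close> equality follows by scaling back with \<open>1/c\<close>, and the case
  \<open>c = 0\<close> yields \<open>q \<zero> \<le> 0\<close>.\<close>

definition sublinear :: "('a \<Rightarrow> real) \<Rightarrow> bool" where
  "sublinear q \<longleftrightarrow> (\<forall>x\<in>car. \<forall>y\<in>car. q (x \<oplus> y) \<le> q x + q y) \<and>
     (\<forall>c\<ge>0. \<forall>x\<in>car. q (c \<odot> x) \<le> c * q x)"

lemma sublinear_norm: "sublinear nrm"
  by (simp add: sublinear_def norm_triangle)

lemma sublinear_zero: "sublinear q \<Longrightarrow> q \<zero> = 0"
proof -
  assume q: "sublinear q"
  have "q (0 \<odot> \<zero>) \<le> 0 * q \<zero>" "q (\<zero> \<oplus> \<zero>) \<le> q \<zero> + q \<zero>"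
    using q unfolding sublinear_def by (meson order_refl zero_closed)+
  then show ?thesis by simp
qed

lemma sublinear_minus: "sublinear q \<Longrightarrow> x \<in> car \<Longrightarrow> - q ((-1) \<odot> x) \<le> q x"
proof -
  assume q: "sublinear q" and x: "x \<in> car"
  have "q (x \<oplus> (-1) \<odot> x) \<le> q x + q ((-1) \<odot> x)"
    using q x by (simp only: sublinear_def scale_closed)
  then show ?thesis using sublinear_zero[OF q] x by simp
qed

text \<open>For sublinear \<open>q\<close> this is the largest sublinear functional below
  \<open>q\<close> whose value at \<open>- a\<close> is at most \<open>- q a\<close>. The default 0
  off the carrier matches the convention of the set \<open>A\<close> to which Zorn's lemma is
  applied below.\<close>

definition descent :: "('a \<Rightarrow> real) \<Rightarrow> 'a \<Rightarrow> 'a \<Rightarrow> real" where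
  "descent q a x = (if x \<in> car then INF t\<in>{0..}. q (x \<oplus> t \<odot> a) - t * q a else 0)"

context
  fixes q a
  assumes q: "sublinear q" and a: "a \<in> car"
begin

text \<open>Since \<open>t a = (x + t a) - x\<close>, subadditivity bounds \<open>t * q a\<close> by
  \<open>q (x + t a) + q (- x)\<close>, uniformly in \<open>t\<close>. So the infimum defining
  \<open>descent\<close> is a real one.\<close>

lemma descent_bdd_below:
  assumes x: "x \<in> car"
  shows "bdd_below ((\<lambda>t. q (x \<oplus> t \<odot> a) - t * q a) ` {0..})"
proof (rule bdd_belowI2)
  fix t :: real assume "t \<in> {0..}"
  then have t: "t \<ge> 0" by simp
  show "- q ((-1) \<odot> x) - q \<zero> \<le> q (x \<oplus> t \<odot> a) - t * q a"
  proof (cases "t = 0")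
    case True
    then show ?thesis using x a sublinear_minus[OF q x] sublinear_zero[OF q] by simp
  next
    case False
    \<comment> \<open>Only the inequality form of homogeneity is available, so it is applied with
      the factor \<open>1/t\<close> to reach \<open>t * q a \<le> q (t \<odot> a)\<close>.\<close>
    have "t * q a = t * q ((1/t) \<odot> t \<odot> a)" using False a by simp
    also have "\<dots> \<le> t * ((1/t) * q (t \<odot> a))"
      using q t a by (intro mult_left_mono) (auto simp only: sublinear_def scale_closed zero_le_divide_1_iff)
    also have "\<dots> = q (t \<odot> a)" using False by simp
    also have "\<dots> = q ((x \<oplus> t \<odot> a) \<oplus> (-1) \<odot> x)"
      using x a by (simp add: add_minus_cancel)
    also have "\<dots> \<le> q (x \<oplus> t \<odot> a) + q ((-1) \<odot> x)"
      using q x a by (simp only: sublinear_def scale_closed add_closed)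
    finally show ?thesis using sublinear_zero[OF q] by simp
  qed
qed

lemma descent_le: "x \<in> car \<Longrightarrow> t \<ge> 0 \<Longrightarrow> descent q a x \<le> q (x \<oplus> t \<odot> a) - t * q a"
  unfolding descent_def by (auto intro!: cINF_lower descent_bdd_below)

lemma descent_le_self: "x \<in> car \<Longrightarrow> descent q a x \<le> q x"
  using descent_le[of x 0] a by simp

lemma le_descent:
  assumes "x \<in> car" "\<And>t. t \<ge> 0 \<Longrightarrow> u \<le> q (x \<oplus> t \<odot> a) - t * q a"
  shows "u \<le> descent q a x"
  unfolding descent_def using assms by (auto intro!: cINF_greatest)

text \<open>For a sum, the parameters \<open>t\<close> and \<open>s\<close> of the two summands
  combine to \<open>t + s\<close>, and the infima over them are taken one after the other. For a
  multiple, the parameter is rescaled to \<open>c * t\<close>.\<close>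

lemma sublinear_descent: "sublinear (descent q a)"
  unfolding sublinear_def
proof (intro conjI ballI allI impI)
  fix x y assume x: "x \<in> car" and y: "y \<in> car"
  have *: "descent q a (x \<oplus> y) \<le> (q (x \<oplus> t \<odot> a) - t * q a) + (q (y \<oplus> s \<odot> a) - s * q a)"
    if "t \<ge> 0" "s \<ge> 0" for s t
  proof -
    have "descent q a (x \<oplus> y) \<le> q ((x \<oplus> y) \<oplus> (t + s) \<odot> a) - (t + s) * q a"
      using x y that by (intro descent_le) auto
    also have "(x \<oplus> y) \<oplus> (t + s) \<odot> a = (x \<oplus> t \<odot> a) \<oplus> (y \<oplus> s \<odot> a)"
      using x y a by (simp add: add_scale add_swap)
    also have "q \<dots> \<le> q (x \<oplus> t \<odot> a) + q (y \<oplus> s \<odot> a)"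
      using q x y a by (simp only: sublinear_def scale_closed add_closed)
    finally show ?thesis by (simp add: algebra_simps)
  qed
  have "descent q a (x \<oplus> y) - (q (x \<oplus> t \<odot> a) - t * q a) \<le> descent q a y" if "t \<ge> 0" for t
    using *[OF that] y by (intro le_descent) (auto simp: algebra_simps)
  then have "descent q a (x \<oplus> y) - descent q a y \<le> descent q a x"
    using x by (intro le_descent) (auto simp: algebra_simps)
  then show "descent q a (x \<oplus> y) \<le> descent q a x + descent q a y" by simp
next
  fix c :: real and x assume c: "c \<ge> 0" and x: "x \<in> car"
  show "descent q a (c \<odot> x) \<le> c * descent q a x"
  proof (cases "c = 0")
    case True
    then show ?thesis using descent_le_self[of \<zero>] x sublinear_zero[OF q] by simp
  next
    case False
    have "descent q a (c \<odot> x) / c \<le> descent q a x"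
    proof (rule le_descent[OF x])
      fix t :: real assume t: "t \<ge> 0"
      have "descent q a (c \<odot> x) \<le> q (c \<odot> x \<oplus> (c * t) \<odot> a) - (c * t) * q a"
        using x c t by (intro descent_le) auto
      also have "c \<odot> x \<oplus> (c * t) \<odot> a = c \<odot> (x \<oplus> t \<odot> a)"
        using x a by (simp add: scale_add)
      also have "q \<dots> \<le> c * q (x \<oplus> t \<odot> a)"
        using q x a c by (simp only: sublinear_def scale_closed add_closed)
      finally have "descent q a (c \<odot> x) \<le> c * (q (x \<oplus> t \<odot> a) - t * q a)"
        by (simp add: algebra_simps)
      then show "descent q a (c \<odot> x) / c \<le> q (x \<oplus> t \<odot> a) - t * q a"
        using c False by (simp add: pos_divide_le_eq mult.commute)
    qed
    then show ?thesis using c False by (simp add: pos_divide_le_eq mult.commute)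
  qed
qed

end

text \<open>A sublinear functional that is minimal among all sublinear functionals is linear, because
  it cannot be lowered by \<^const>\<open>descent\<close> in any direction.\<close>

lemma ex_linear_below_sublinear:
  assumes p: "sublinear p"
  obtains f where "\<And>x. x \<in> car \<Longrightarrow> f x \<le> p x"
    "\<And>x y. x \<in> car \<Longrightarrow> y \<in> car \<Longrightarrow> f (x \<oplus> y) = f x + f y"
    "\<And>c x. x \<in> car \<Longrightarrow> f (c \<odot> x) = c * f x"
proof -
  define A where "A = {q. sublinear q \<and> (\<forall>x\<in>car. q x \<le> p x) \<and> (\<forall>x. x \<notin> car \<longrightarrow> q x = 0)}"
  \<comment> \<open>The order is reversed, so that a maximal element in the sense of Zorn is a
    minimal functional.\<close>
  define P where "P = (\<lambda>q q' :: 'a \<Rightarrow> real. q' \<le> q)"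
  have pA: "(\<lambda>x. if x \<in> car then p x else 0) \<in> A"
    using p by (auto simp: A_def sublinear_def)
  have "\<exists>m\<in>A. \<forall>q\<in>A. P m q \<longrightarrow> q = m"
  proof (rule predicate_Zorn)
    show "partial_order_on A (relation_of P A)"
      by (rule partial_order_on_relation_ofI) (auto simp: P_def)
  next
    fix C assume "C \<in> Chains (relation_of P A)"
    then have CA: "q \<in> A" and chain: "q' \<in> C \<Longrightarrow> q \<le> q' \<or> q' \<le> q" if "q \<in> C" for q q'
      using that by (auto simp: Chains_def relation_of_def P_def)
    show "\<exists>u\<in>A. \<forall>q\<in>C. P q u"
    proof (cases "C = {}")
      case True
      then show ?thesis using pA by blast
    next
      case False
      define u where "u = (\<lambda>x. INF q\<in>C. q x)"
      \<comment> \<open>The bound \<open>- p (- x) \<le> - q (- x) \<le> q x\<close> does not depend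
        on \<open>q\<close>, so the pointwise infimum of the chain is finite.\<close>
      have bdd: "bdd_below ((\<lambda>q. q x) ` C)" for x
      proof (rule bdd_belowI2)
        fix q assume "q \<in> C"
        then have qA: "q \<in> A" by (rule CA)
        show "(if x \<in> car then - p ((-1) \<odot> x) else 0) \<le> q x"
        proof (cases "x \<in> car")
          case True
          then have "q ((-1) \<odot> x) \<le> p ((-1) \<odot> x)" "- q ((-1) \<odot> x) \<le> q x"
            using qA sublinear_minus by (auto simp: A_def)
          then show ?thesis using True by simp
        qed (use qA in \<open>auto simp: A_def\<close>)
      qed
      have u_le: "u x \<le> q x" if "q \<in> C" for q x
        unfolding u_def using that bdd by (rule cINF_lower[rotated])
      have le_u: "v \<le> u x" if "\<And>q. q \<in> C \<Longrightarrow> v \<le> q x" for v x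
        unfolding u_def using False that by (rule cINF_greatest)
      have "sublinear u"
        unfolding sublinear_def
      proof (intro conjI ballI allI impI)
        fix x y assume x: "x \<in> car" and y: "y \<in> car"
        \<comment> \<open>Of two members of a chain the smaller one can be used for both summands,
          and it is sublinear.\<close>
        have *: "u (x \<oplus> y) \<le> q x + q' y" if "q \<in> C" "q' \<in> C" for q q'
        proof -
          have sub: "r (x \<oplus> y) \<le> r x + r y" if "r \<in> C" for r
            using CA[OF that] x y by (simp add: A_def sublinear_def)
          from chain[OF that] show ?thesis
          proof
            assume "q \<le> q'"
            then show ?thesis using sub[OF that(1)] u_le[OF that(1), of "x \<oplus> y"]
              by (auto simp: le_fun_def intro: order_trans add_left_mono)
          next
            assume "q' \<le> q"
            then show ?thesis using sub[OF that(2)] u_le[OF that(2), of "x \<oplus> y"]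
              by (auto simp: le_fun_def intro: order_trans add_right_mono)
          qed
        qed
        have "u (x \<oplus> y) - q x \<le> u y" if "q \<in> C" for q
          using *[OF that] by (intro le_u) (auto simp: algebra_simps)
        then have "u (x \<oplus> y) - u y \<le> u x"
          by (intro le_u) (auto simp: algebra_simps)
        then show "u (x \<oplus> y) \<le> u x + u y" by simp
      next
        fix c :: real and x assume c: "c \<ge> 0" and x: "x \<in> car"
        have *: "u (c \<odot> x) \<le> c * q x" if "q \<in> C" for q
        proof -
          have "q (c \<odot> x) \<le> c * q x"
            using CA[OF that] c x by (simp add: A_def sublinear_def)
          then show ?thesis using u_le[OF that, of "c \<odot> x"] by simp
        qed
        show "u (c \<odot> x) \<le> c * u x"
        proof (cases "c = 0")
          case True
          then show ?thesis using * False by auto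
        next
          case False
          then have "u (c \<odot> x) / c \<le> u x"
            using * c by (intro le_u) (simp add: pos_divide_le_eq mult.commute)
          then show ?thesis using c False by (simp add: pos_divide_le_eq mult.commute)
        qed
      qed
      moreover have "u x = 0" if "x \<notin> car" for x
      proof -
        obtain q where "q \<in> C" using False by blast
        show ?thesis
          using that u_le[OF \<open>q \<in> C\<close>, of x] CA[OF \<open>q \<in> C\<close>]
          by (intro antisym le_u) (auto simp: A_def dest!: CA)
      qed
      moreover have "u x \<le> p x" if "x \<in> car" for x
      proof -
        obtain q where "q \<in> C" using False by blast
        then show ?thesis
          using that u_le[of q x] CA[of q] by (force simp: A_def)
      qed
      ultimately have "u \<in> A" by (simp add: A_def)
      then show ?thesis using u_le by (auto simp: P_def le_fun_def)
    qed
  qed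
  then obtain f where fA: "f \<in> A" and min: "\<And>q. q \<in> A \<Longrightarrow> q \<le> f \<Longrightarrow> q = f"
    by (auto simp: P_def)
  have f: "sublinear f" using fA by (simp add: A_def)
  have add: "f (x \<oplus> a) = f x + f a" if x: "x \<in> car" and a: "a \<in> car" for x a
  proof -
    have le: "descent f a z \<le> f z" for z
      using descent_le_self[OF f a, of z] fA by (cases "z \<in> car") (auto simp: A_def descent_def)
    have "descent f a z \<le> p z" if "z \<in> car" for z
    proof -
      have "f z \<le> p z" using fA that by (simp add: A_def)
      then show ?thesis using le[of z] by simp
    qed
    moreover have "descent f a z = 0" if "z \<notin> car" for z
      using that by (simp add: descent_def)
    ultimately have "descent f a \<in> A"
      using sublinear_descent[OF f a] by (simp add: A_def)
    then have "descent f a = f"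
      using le by (intro min) (auto simp: le_fun_def)
    \<comment> \<open>The parameter \<open>t = 1\<close> in \<open>descent f a x = f x\<close> gives
      superadditivity.\<close>
    then have "f x \<le> f (x \<oplus> 1 \<odot> a) - 1 * f a"
      using descent_le[OF f a x, of 1] by simp
    moreover have "f (x \<oplus> a) \<le> f x + f a"
      using f x a by (simp add: sublinear_def)
    ultimately show ?thesis using a by simp
  qed
  have minus: "f ((-1) \<odot> x) = - f x" if "x \<in> car" for x
    using add[of x "(-1) \<odot> x"] that sublinear_zero[OF f] by simp
  have pos: "f (c \<odot> x) = c * f x" if "x \<in> car" "c \<ge> 0" for c x
  proof -
    have "f (c \<odot> x) \<le> c * f x" using f that by (simp add: sublinear_def)
    \<comment> \<open>Homogeneity at \<open>- x\<close> supplies the reverse inequality, as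
      \<open>f\<close> is already known to be odd.\<close>
    moreover have "f (c \<odot> (-1) \<odot> x) \<le> c * f ((-1) \<odot> x)"
      using f that by (simp only: sublinear_def scale_closed)
    moreover have "f (c \<odot> (-1) \<odot> x) = - f (c \<odot> x)"
      using minus[of "c \<odot> x"] that by simp
    ultimately show ?thesis using minus that by simp
  qed
  have "f (c \<odot> x) = c * f x" if x: "x \<in> car" for c x
  proof (cases "c \<ge> 0")
    case False
    then have "f ((-c) \<odot> (-1) \<odot> x) = (-c) * f ((-1) \<odot> x)"
      using x by (intro pos) auto
    then show ?thesis using minus x by simp
  qed (use pos x in auto)
  then show thesis using that[of f] add fA by (simp add: A_def)
qed

text \<open>A linear functional below \<open>descent nrm y\<close> is norming at \<open>y\<close>, since
  \<open>descent nrm y (- y) \<le> nrm (- y + y) - nrm y = - nrm y\<close>.\<close>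

lemma ex_norming_functional:
  assumes y: "y \<in> car"
  obtains f where "bounded_linear_map V real_line f" "\<And>x. x \<in> car \<Longrightarrow> \<bar>f x\<bar> \<le> nrm x" "f y = nrm y"
proof -
  obtain f where le: "\<And>x. x \<in> car \<Longrightarrow> f x \<le> descent nrm y x"
    and add: "\<And>x z. x \<in> car \<Longrightarrow> z \<in> car \<Longrightarrow> f (x \<oplus> z) = f x + f z"
    and scale: "\<And>c x. x \<in> car \<Longrightarrow> f (c \<odot> x) = c * f x"
    using ex_linear_below_sublinear[OF sublinear_descent[OF sublinear_norm y]] by metis
  have le_norm: "f x \<le> nrm x" if "x \<in> car" for x
    using le[OF that] descent_le_self[OF sublinear_norm y that] by simp
  have abs: "\<bar>f x\<bar> \<le> nrm x" if "x \<in> car" for x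
    using le_norm[OF that] le_norm[of "(-1) \<odot> x"] scale[OF that, of "-1"] that by simp
  have "descent nrm y ((-1) \<odot> y) \<le> - nrm y"
    using descent_le[OF sublinear_norm y, of "(-1) \<odot> y" 1] y
    by (simp add: add_comm[of "(-1) \<odot> y" y] sublinear_zero[OF sublinear_norm])
  then have "nrm y \<le> f y"
    using le[of "(-1) \<odot> y"] scale[OF y, of "-1"] y by simp
  then have "f y = nrm y" using le_norm[OF y] by simp
  moreover have "bounded_linear_map V real_line f"
    using add scale abs by (auto simp: bounded_linear_map_def real_line_def intro!: exI[of _ 1])
  ultimately show thesis using that abs by blast
qed

end

section \<open>Weak convergence, weak continuity and weakly compact operators\<close>

lemma bounded_linear_map_zero: "bounded_linear_map V real_line (\<lambda>_. 0)"
  by (auto simp: bounded_linear_map_def real_line_def intro!: exI[of _ 0])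

text \<open>The zero functional contributes the whole carrier as a subbasic open set.\<close>

lemma topspace_weak_topology [simp]: "topspace (weak_topology V) = vcarrier V"
  unfolding weak_topology_def topology_generated_by_topspace
  using bounded_linear_map_zero[of V] by (auto intro!: exI[of _ "{x \<in> vcarrier V. (0::real) \<in> UNIV}"] exI[of _ "\<lambda>_. 0::real"])

lemma openin_weak_topology:
  "bounded_linear_map V real_line f \<Longrightarrow> open U \<Longrightarrow> openin (weak_topology V) {x \<in> vcarrier V. f x \<in> U}"
  unfolding weak_topology_def by (rule topology_generated_by_Basis) blast

lemma continuous_map_into_weak_topology:
  assumes range: "g ` topspace X \<subseteq> vcarrier V"
    and cont: "\<And>f. bounded_linear_map V real_line f \<Longrightarrow> continuous_map X euclideanreal (f \<circ> g)"
  shows "continuous_map X (weak_topology V) g"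
proof -
  have "openin X (g -` {x \<in> vcarrier V. f x \<in> W} \<inter> topspace X)"
    if "bounded_linear_map V real_line f" "open W" for f W
  proof -
    have "openin X {t \<in> topspace X. (f \<circ> g) t \<in> W}"
      using cont[OF that(1)] that(2) by (simp add: continuous_map_def)
    also have "{t \<in> topspace X. (f \<circ> g) t \<in> W} = g -` {x \<in> vcarrier V. f x \<in> W} \<inter> topspace X"
      using range by auto
    finally show ?thesis .
  qed
  moreover have "g ` topspace X \<subseteq> topspace (weak_topology V)"
    using range by simp
  ultimately show ?thesis
    unfolding weak_topology_def continuous_on_generated_topo_iff topology_generated_by_topspace
    by blast
qed

text \<open>Eventual membership passes from the subbasic sets to binary intersections and arbitrary
  unions, so it is enough to test one functional at a time.\<close>

lemma limitin_weak_topology: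
  assumes "l \<in> vcarrier V" "range x \<subseteq> vcarrier V"
  shows "limitin (weak_topology V) x l sequentially \<longleftrightarrow>
    (\<forall>f. bounded_linear_map V real_line f \<longrightarrow> (\<lambda>n. f (x n)) \<longlonglongrightarrow> f l)"
  (is "?L \<longleftrightarrow> ?R")
proof
  assume L: ?L
  show ?R
  proof (intro allI impI topological_tendstoI)
    fix f and U :: "real set" assume "bounded_linear_map V real_line f" "open U" "f l \<in> U"
    then have "\<forall>\<^sub>F n in sequentially. x n \<in> {z \<in> vcarrier V. f z \<in> U}"
      using L openin_weak_topology[of V f U] assms(1) unfolding limitin_def by blast
    then show "\<forall>\<^sub>F n in sequentially. f (x n) \<in> U"
      by (rule eventually_mono) simp
  qed
next
  assume R: ?R
  show ?L
    unfolding limitin_def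
  proof (intro conjI allI impI)
    fix U assume U: "openin (weak_topology V) U \<and> l \<in> U"
    then have "generate_topology_on {{z \<in> vcarrier V. f z \<in> W} | f W. bounded_linear_map V real_line f \<and> open W} U"
      unfolding weak_topology_def by (intro openin_topology_generated_by) simp
    then have "l \<in> U \<longrightarrow> (\<forall>\<^sub>F n in sequentially. x n \<in> U)"
    proof (induction)
      case (Basis s)
      then obtain f W where s: "s = {z \<in> vcarrier V. f z \<in> W}"
        and f: "bounded_linear_map V real_line f" "open W" by blast
      show ?case
      proof
        assume "l \<in> s"
        then have "\<forall>\<^sub>F n in sequentially. f (x n) \<in> W"
          using R f s by (auto intro: topological_tendstoD)
        then show "\<forall>\<^sub>F n in sequentially. x n \<in> s"
          by (rule eventually_mono) (use assms(2) s in auto)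
      qed
    next
      case (UN K)
      show ?case
      proof
        assume "l \<in> \<Union>K"
        then obtain k where "k \<in> K" "l \<in> k" by blast
        then have "\<forall>\<^sub>F n in sequentially. x n \<in> k" using UN.IH by blast
        then show "\<forall>\<^sub>F n in sequentially. x n \<in> \<Union>K"
          by (rule eventually_mono) (use \<open>k \<in> K\<close> in blast)
      qed
    qed (auto simp: eventually_conj_iff)
    then show "\<forall>\<^sub>F n in sequentially. x n \<in> U" using U by blast
  qed (use assms in simp)
qed

text \<open>The bounding constants may be negative; nonnegativity of the norms allows them to be
  replaced by their absolute values before they are multiplied.\<close>

lemma bounded_linear_map_compose:
  assumes "bounded_linear_map V W T" "bounded_linear_map W X S"
    and nonneg: "\<And>x. x \<in> vcarrier V \<Longrightarrow> 0 \<le> vnorm V x" "\<And>x. x \<in> vcarrier W \<Longrightarrow> 0 \<le> vnorm W x"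
  shows "bounded_linear_map V X (S \<circ> T)"
proof -
  obtain C where C: "\<And>x. x \<in> vcarrier V \<Longrightarrow> vnorm W (T x) \<le> C * vnorm V x"
    using assms(1) unfolding bounded_linear_map_def by blast
  obtain D where D: "\<And>x. x \<in> vcarrier W \<Longrightarrow> vnorm X (S x) \<le> D * vnorm W x"
    using assms(2) unfolding bounded_linear_map_def by blast
  have "vnorm X (S (T x)) \<le> (\<bar>D\<bar> * \<bar>C\<bar>) * vnorm V x" if x: "x \<in> vcarrier V" for x
  proof -
    have Tx: "T x \<in> vcarrier W" using assms(1) x by (simp add: bounded_linear_map_def)
    have "vnorm X (S (T x)) \<le> \<bar>D\<bar> * vnorm W (T x)"
      using D[OF Tx] nonneg(2)[OF Tx] by (meson abs_ge_self mult_right_mono order_trans)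
    also have "\<dots> \<le> \<bar>D\<bar> * (\<bar>C\<bar> * vnorm V x)"
      using C[OF x] nonneg(1)[OF x]
      by (intro mult_left_mono) (auto intro: mult_right_mono[OF abs_ge_self] order_trans)
    finally show ?thesis by (simp add: mult.assoc)
  qed
  then show ?thesis
    using assms(1,2) unfolding bounded_linear_map_def by auto
qed

context banach_struct
begin

text \<open>A norming functional of the nonzero vector \<open>x - y\<close> takes different values
  at \<open>x\<close> and \<open>y\<close>.\<close>

lemma Hausdorff_weak_topology: "Hausdorff_space (weak_topology V)"
  unfolding Hausdorff_space_def
proof (intro allI impI)
  fix x y assume "x \<in> topspace (weak_topology V) \<and> y \<in> topspace (weak_topology V) \<and> x \<noteq> y"
  then have x: "x \<in> car" and y: "y \<in> car" and ne: "x \<noteq> y" by auto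
  obtain f where f: "bounded_linear_map V real_line f" "f (x \<oplus> (-1) \<odot> y) = nrm (x \<oplus> (-1) \<odot> y)"
    using ex_norming_functional[of "x \<oplus> (-1) \<odot> y"] x y by (metis add_closed scale_closed)
  have "f (x \<oplus> (-1) \<odot> y) = f x - f y"
    using f(1) x y by (simp add: bounded_linear_map_def real_line_def)
  moreover have "nrm (x \<oplus> (-1) \<odot> y) \<noteq> 0"
    using ne eq_of_diff_eq_zero[OF x y] x y by (subst norm_eq_zero) auto
  ultimately have "f x \<noteq> f y" using f(2) by auto
  then obtain A B where AB: "open A" "open B" "f x \<in> A" "f y \<in> B" "A \<inter> B = {}"
    by (meson hausdorff)
  then show "\<exists>U W. openin (weak_topology V) U \<and> openin (weak_topology V) W \<and> x \<in> U \<and> y \<in> W \<and> disjnt U W"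
    using x y by (intro exI[of _ "{z \<in> car. f z \<in> A}"] exI[of _ "{z \<in> car. f z \<in> B}"])
      (auto simp: disjnt_def openin_weak_topology[OF f(1)])
qed

end

text \<open>A bounded operator is weak-to-weak continuous, so \<open>S\<close> maps the compact
  closure \<open>?K\<close> to a compact set, which is closed because the target is Hausdorff. The
  closure of the image of the ball is a closed subset of it.\<close>

lemma weakly_compact_operator_compose:
  assumes "weakly_compact_operator V W T" "bounded_linear_map W X S" "banach_space W" "banach_space X"
    and "\<And>x. x \<in> vcarrier V \<Longrightarrow> 0 \<le> vnorm V x"
  shows "weakly_compact_operator V X (S \<circ> T)"
proof -
  interpret W: banach_struct W by unfold_locales (rule assms)
  interpret X: banach_struct X by unfold_locales (rule assms)
  let ?B = "{x \<in> vcarrier V. vnorm V x \<le> 1}"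
  let ?K = "weak_topology W closure_of (T ` ?B)"
  have T: "bounded_linear_map V W T" and K: "compactin (weak_topology W) ?K"
    using assms(1) by (auto simp: weakly_compact_operator_def)
  have "continuous_map (weak_topology W) (weak_topology X) S"
  proof (rule continuous_map_into_weak_topology)
    show "S ` topspace (weak_topology W) \<subseteq> vcarrier X"
      using assms(2) by (auto simp: bounded_linear_map_def)
    fix f assume "bounded_linear_map X real_line f"
    then have fS: "bounded_linear_map W real_line (f \<circ> S)"
      by (rule bounded_linear_map_compose[OF assms(2)]) auto
    show "continuous_map (weak_topology W) euclideanreal (f \<circ> S)"
      using openin_weak_topology[OF fS] by (simp add: continuous_map_def)
  qed
  then have SK: "compactin (weak_topology X) (S ` ?K)"
    by (rule image_compactin[OF K])
  have "T ` ?B \<subseteq> ?K"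
    using T by (intro closure_of_subset) (auto simp: bounded_linear_map_def)
  then have "weak_topology X closure_of ((S \<circ> T) ` ?B) \<subseteq> S ` ?K"
    by (intro closure_of_minimal compactin_imp_closedin[OF X.Hausdorff_weak_topology SK]) auto
  then have "compactin (weak_topology X) (weak_topology X closure_of ((S \<circ> T) ` ?B))"
    by (intro closed_compactin[OF SK]) auto
  moreover have "bounded_linear_map V X (S \<circ> T)"
    using assms(5) by (intro bounded_linear_map_compose[OF T assms(2)]) auto
  ultimately show ?thesis by (simp add: weakly_compact_operator_def)
qed

lemma weakly_null_iff:
  assumes "vzero V \<in> vcarrier V"
  shows "weakly_null V x \<longleftrightarrow> range x \<subseteq> vcarrier V \<and>
    (\<forall>f. bounded_linear_map V real_line f \<longrightarrow> (\<lambda>n. f (x n)) \<longlonglongrightarrow> f (vzero V))"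
  using limitin_weak_topology[OF assms] unfolding weakly_null_def by blast

lemma weakly_null_image:
  assumes x: "weakly_null V x" and T: "bounded_linear_map V W T"
    and zero: "T (vzero V) = vzero W" "vzero V \<in> vcarrier V"
    and nonneg: "\<And>x. x \<in> vcarrier V \<Longrightarrow> 0 \<le> vnorm V x" "\<And>x. x \<in> vcarrier W \<Longrightarrow> 0 \<le> vnorm W x"
  shows "weakly_null W (\<lambda>n. T (x n))"
proof -
  have zW: "vzero W \<in> vcarrier W"
    using T zero by (metis bounded_linear_map_def)
  have "(\<lambda>n. f (T (x n))) \<longlonglongrightarrow> f (vzero W)" if "bounded_linear_map W real_line f" for f
  proof -
    have "bounded_linear_map V real_line (f \<circ> T)"
      by (rule bounded_linear_map_compose[OF T that]) (fact nonneg)+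
    then have "(\<lambda>n. (f \<circ> T) (x n)) \<longlonglongrightarrow> (f \<circ> T) (vzero V)"
      using x unfolding weakly_null_iff[OF zero(2)] by blast
    then show ?thesis using zero by simp
  qed
  moreover have "range (\<lambda>n. T (x n)) \<subseteq> vcarrier W"
    using x T by (auto simp: weakly_null_def bounded_linear_map_def)
  ultimately show ?thesis using zW by (simp add: weakly_null_iff)
qed

section \<open>Spaces of bounded sequences with a prescribed carrier type\<close>

text \<open>The bounded functions form a type of their own, whereas the hypothesis on the ideal
  speaks of codomains with elements in a function type; the Banach space structure is carried over
  along an injection \<open>J\<close>.\<close>

definition copy_struct :: "('b::{real_normed_vector,complete_space} \<Rightarrow> 'c) \<Rightarrow> 'c normed_struct" where
  "copy_struct J =
     \<lparr>vcarrier = range J, vadd = (\<lambda>u v. J (inv J u + inv J v)), vzero = J 0,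
      vscale = (\<lambda>c u. J (c *\<^sub>R inv J u)), vnorm = (\<lambda>u. norm (inv J u))\<rparr>"

lemma copy_struct_simps [simp]:
  "vcarrier (copy_struct J) = range J"
  "vadd (copy_struct J) u v = J (inv J u + inv J v)"
  "vzero (copy_struct J) = J 0"
  "vscale (copy_struct J) c u = J (c *\<^sub>R inv J u)"
  "vnorm (copy_struct J) u = norm (inv J u)"
  by (simp_all add: copy_struct_def)

text \<open>On the range of \<open>J\<close> the inverse is an isometry, so the axioms and the
  limits of Cauchy sequences come from the type \<open>'b\<close>.\<close>

lemma banach_space_copy_struct:
  fixes J :: "'b::{real_normed_vector,complete_space} \<Rightarrow> 'c"
  assumes J: "inj J"
  shows "banach_space (copy_struct J)"
proof -
  define d where "d u v = dist (inv J u) (inv J v)" for u v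
  interpret Metric_space "range J" d
  proof
    show "d u v = 0 \<longleftrightarrow> u = v" if "u \<in> range J" "v \<in> range J" for u v
      using that J by (auto simp: d_def)
    show "d u v = d v u" for u v unfolding d_def by (rule dist_commute)
    show "d u w \<le> d u v + d v w" for u v w unfolding d_def by (rule dist_triangle)
  qed (simp add: d_def)
  have "mcomplete"
    unfolding mcomplete_def
  proof (intro allI impI)
    fix \<sigma> assume \<sigma>: "MCauchy \<sigma>"
    have "Cauchy (\<lambda>n. inv J (\<sigma> n))"
      using \<sigma> by (auto simp: Cauchy_def MCauchy_def d_def)
    then obtain l where l: "(\<lambda>n. inv J (\<sigma> n)) \<longlonglongrightarrow> l"
      using Cauchy_convergent convergent_def by blast
    have "limitin mtopology \<sigma> (J l) sequentially"
      unfolding limitin_metric_dist_null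
    proof (intro conjI)
      show "\<forall>\<^sub>F n in sequentially. \<sigma> n \<in> range J"
        using \<sigma> by (intro always_eventually) (auto simp: MCauchy_def)
      show "(\<lambda>n. d (\<sigma> n) (J l)) \<longlonglongrightarrow> 0"
        using tendsto_dist_iff[THEN iffD1, OF l] by (simp add: d_def J)
    qed simp
    then show "\<exists>x. limitin mtopology \<sigma> x sequentially" ..
  qed
  moreover have eq: "(\<lambda>x y. vnorm (copy_struct J) (vadd (copy_struct J) x (vscale (copy_struct J) (-1) y))) = d"
    by (intro ext) (simp add: d_def J dist_norm)
  ultimately show ?thesis
    unfolding banach_space_def eq copy_struct_simps
    by (simp add: J inj_eq algebra_simps norm_triangle_ineq)
qed

text \<open>The operator \<open>w \<mapsto> (\<phi> n w *\<^sub>R e)\<^sub>n\<close>, with \<open>\<phi> n\<close> norming at \<open>z n\<close>, maps into the bounded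
  sequences in \<open>'b\<close>; it moves the sequence \<open>z\<close> to a space with carrier in \<^typ>\<open>nat \<Rightarrow> 'b\<close>
  without decreasing norms.\<close>

lemma ex_norming_operator:
  fixes F :: "'f normed_struct" and z :: "nat \<Rightarrow> 'f" and e :: "'b::banach"
  assumes F: "banach_space F" and z: "range z \<subseteq> vcarrier F" and e: "norm e = 1"
  obtains G :: "(nat \<Rightarrow> 'b) normed_struct" and S where
    "banach_space G" "bounded_linear_map F G S" "\<And>n. vnorm F (z n) \<le> vnorm G (S (z n))"
proof -
  interpret F: banach_struct F by unfold_locales (rule F)
  have "\<exists>f. bounded_linear_map F real_line f \<and> (\<forall>w\<in>F.car. \<bar>f w\<bar> \<le> F.nrm w) \<and> f (z n) = F.nrm (z n)" for n
    using F.ex_norming_functional[of "z n"] z by (metis range_subsetD)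
  then obtain \<phi> where \<phi>: "\<And>n. bounded_linear_map F real_line (\<phi> n)"
    "\<And>n w. w \<in> F.car \<Longrightarrow> \<bar>\<phi> n w\<bar> \<le> F.nrm w" "\<And>n. \<phi> n (z n) = F.nrm (z n)"
    by metis
  \<comment> \<open>On a discrete space every function is continuous, so the bounded continuous
    functions are exactly the bounded sequences.\<close>
  define J :: "(nat discrete \<Rightarrow>\<^sub>C 'b) \<Rightarrow> nat \<Rightarrow> 'b" where "J g = (\<lambda>n. g (discrete n))" for g
  have J: "inj J"
    by (rule injI, rule bcontfun_eqI) (metis J_def discrete_cases)
  define S where "S w = (\<lambda>n. \<phi> n w *\<^sub>R e)" for w
  define S' where "S' w = Bcontfun (\<lambda>k. S w (of_discrete k))" for w
  have S': "S w = J (S' w)" if "w \<in> F.car" for w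
  proof -
    have "(\<lambda>k. S w (of_discrete k)) \<in> bcontfun"
      \<comment> \<open>The functionals \<open>\<phi> n\<close> all have norm at most 1, so the norm
        of \<open>w\<close> bounds every coordinate.\<close>
      by (rule bcontfun_normI[where b = "F.nrm w"])
        (auto simp: S_def e \<phi>(2)[OF that] continuous_on_open_vimage open_discrete)
    then show ?thesis by (simp add: S'_def J_def Bcontfun_inverse discrete_inverse)
  qed
  have inv_S: "inv J (S w) = S' w" if "w \<in> F.car" for w
    by (simp add: S'[OF that] J)
  have J_apply: "J (S' w) n = \<phi> n w *\<^sub>R e" if "w \<in> F.car" for w n
    using S'[OF that] by (metis S_def)
  have norm_S': "norm (S' w) \<le> F.nrm w" if "w \<in> F.car" for w
  proof (rule norm_bound)
    show "norm (S' w k) \<le> F.nrm w" for k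
      using J_apply[OF that, of "of_discrete k"] \<phi>(2)[OF that] by (simp add: J_def of_discrete_inverse e)
  qed
  have "bounded_linear_map F (copy_struct J) S"
    unfolding bounded_linear_map_def copy_struct_simps
  proof (intro conjI ballI allI)
    show "S w \<in> range J" if "w \<in> F.car" for w using S'[OF that] by simp
    show "S (vadd F v w) = J (inv J (S v) + inv J (S w))" if "v \<in> F.car" "w \<in> F.car" for v w
    proof
      fix n
      have "\<phi> n (vadd F v w) = \<phi> n v + \<phi> n w"
        using \<phi>(1)[of n] that by (simp add: bounded_linear_map_def real_line_def)
      then have "S (vadd F v w) n = J (S' v) n + J (S' w) n"
        using that by (simp add: J_apply S_def scaleR_add_left)
      then show "S (vadd F v w) n = J (inv J (S v) + inv J (S w)) n"
        by (simp add: inv_S that J_def)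
    qed
    show "S (vscale F c w) = J (c *\<^sub>R inv J (S w))" if "w \<in> F.car" for c w
    proof
      fix n
      have "\<phi> n (vscale F c w) = c * \<phi> n w"
        using \<phi>(1)[of n] that by (simp add: bounded_linear_map_def real_line_def)
      then have "S (vscale F c w) n = c *\<^sub>R J (S' w) n"
        using that by (simp add: J_apply S_def)
      then show "S (vscale F c w) n = J (c *\<^sub>R inv J (S w)) n"
        by (simp add: inv_S that J_def)
    qed
    show "\<exists>C. \<forall>w\<in>F.car. norm (inv J (S w)) \<le> C * F.nrm w"
      using norm_S' by (intro exI[of _ 1]) (simp add: inv_S)
  qed
  moreover have "F.nrm (z n) \<le> vnorm (copy_struct J) (S (z n))" for n
  proof -
    have zn: "z n \<in> F.car" using z by blast
    have "F.nrm (z n) = norm (J (S' (z n)) n)"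
      using J_apply[OF zn] \<phi>(3) zn e by simp
    \<comment> \<open>The supremum norm dominates the \<open>n\<close>-th coordinate, where
      \<open>\<phi> n\<close> attains the norm of \<open>z n\<close>.\<close>
    also have "\<dots> \<le> norm (S' (z n))" unfolding J_def by (rule norm_bounded)
    finally show ?thesis by (simp add: inv_S[OF zn])
  qed
  ultimately show thesis using that banach_space_copy_struct[OF J] by blast
qed

section \<open>Functionals on ideals of Banach lattices\<close>

lemma pos_part_diff: "(x::'a::banach_lattice) = pprt x - pprt (- x)"
  and abs_pos_part: "\<bar>x\<bar> = pprt x + pprt (- x)"
  using prts[of x] abs_prts[of x] by (simp_all add: pprt_neg)

lemma pprt_le_abs: "pprt (x::'a::banach_lattice) \<le> \<bar>x\<bar>"
  using zero_le_pprt[of "- x"] by (simp add: abs_pos_part)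

lemma norm_abs [simp]: "norm \<bar>x::'a::banach_lattice\<bar> = norm x"
  by (intro antisym norm_mono_abs) simp_all

lemma norm_pprt_le: "norm (pprt (x::'a::banach_lattice)) \<le> norm x"
  by (rule norm_mono_abs) (simp add: pprt_le_abs)

text \<open>By distributivity the right-hand side is the infimum of \<open>a + b\<close>,
  \<open>c + b\<close>, \<open>a + c\<close> and \<open>c + c\<close>; the first is a bound on the
  left, and the other three are at least \<open>c\<close>.\<close>

lemma inf_add_le:
  fixes a b c :: "'a::lattice_ab_group_add"
  assumes "0 \<le> a" "0 \<le> b" "0 \<le> c"
  shows "inf (a + b) c \<le> inf a c + inf b c"
proof -
  have "inf (a + b) c \<le> inf (inf (a + b) (c + b)) (inf (a + c) (c + c))"
    using assms by (auto intro: le_infI1 le_infI2 add_increasing add_increasing2)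
  also have "\<dots> = inf a c + inf b c"
    by (simp add: add_inf_distrib_left add_inf_distrib_right inf_assoc)
  finally show ?thesis .
qed

text \<open>Translation by \<open>pprt (- x)\<close> turns the infimum into
  \<open>pprt (- x) + inf x 0\<close>, and \<open>inf x 0\<close> is
  \<open>- pprt (- x)\<close>.\<close>

lemma inf_pprt_minus: "inf (pprt x) (pprt (- x)) = (0 :: 'a::lattice_ab_group_add)"
proof -
  have "inf (pprt x) (pprt (- x)) = pprt (- x) + inf (pprt x - pprt (- x)) 0"
    by (simp add: add_inf_distrib_left)
  also have "pprt x - pprt (- x) = x"
    using prts[of x] by (simp add: pprt_neg)
  finally show ?thesis
    by (simp add: pprt_neg nprt_def[symmetric])
qed

text \<open>The witnesses are \<open>u = inf z x\<close> and \<open>v = z - u\<close>; the bound on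
  \<open>v\<close> holds because \<open>z - y\<close> lies below both \<open>z\<close> and
  \<open>x\<close>.\<close>

lemma riesz_decomposition:
  fixes x y z :: "'a::lattice_ab_group_add"
  assumes "0 \<le> z" "z \<le> x + y" "0 \<le> x" "0 \<le> y"
  obtains u v where "z = u + v" "0 \<le> u" "u \<le> x" "0 \<le> v" "v \<le> y"
proof
  show "z = inf z x + (z - inf z x)" by (simp del: diff_inf_eq_sup)
  have "z - y \<le> inf z x"
    using assms by (simp add: diff_le_eq)
  then have "z \<le> inf z x + y" by (simp only: diff_le_eq)
  then show "z - inf z x \<le> y" by (simp only: diff_le_eq add.commute)
  show "0 \<le> z - inf z x" by (metis diff_ge_0_iff_ge inf_le1)
  show "0 \<le> inf z x" "inf z x \<le> x" using assms by simp_all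
qed

section \<open>Extension and domination of functionals given on an ideal\<close>

text \<open>One notion that covers \<open>I\<close>, the whole lattice and disjoint
  complements.\<close>

definition ideal :: "'a::banach_lattice set \<Rightarrow> bool" where
  "ideal J \<longleftrightarrow> subspace J \<and> (\<forall>x y. y \<in> J \<and> \<bar>x\<bar> \<le> \<bar>y\<bar> \<longrightarrow> x \<in> J)"

text \<open>Kantorovich's extension from the positive cone: the value at \<open>x\<close> is the
  difference of the values at its positive and negative parts.\<close>

lemma bounded_linear_of_pos_additive:
  fixes q :: "'a::banach_lattice \<Rightarrow> real"
  assumes add: "\<And>x y. 0 \<le> x \<Longrightarrow> 0 \<le> y \<Longrightarrow> q (x + y) = q x + q y"
    and scale: "\<And>c x. 0 < c \<Longrightarrow> 0 \<le> x \<Longrightarrow> q (c *\<^sub>R x) = c * q x"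
    and bound: "\<And>x. 0 \<le> x \<Longrightarrow> \<bar>q x\<bar> \<le> C * norm x"
  obtains g where "bounded_linear g" "\<And>x. 0 \<le> x \<Longrightarrow> g x = q x"
proof
  define g where "g = (\<lambda>x. q (pprt x) - q (pprt (- x)))"
  have q0: "q 0 = 0" using add[of 0 0] by simp
  \<comment> \<open>Any decomposition into a difference of positive vectors gives the same value;
    additivity of \<open>g\<close> rests on this.\<close>
  have g_diff: "g (a - b) = q a - q b" if "0 \<le> a" "0 \<le> b" for a b
  proof -
    have "pprt (a - b) + b = pprt (- (a - b)) + a"
      using pos_part_diff[of "a - b"] by (simp add: algebra_simps)
    then have "q (pprt (a - b)) + q b = q (pprt (- (a - b))) + q a"
      using that by (metis add zero_le_pprt)
    then show ?thesis by (simp add: g_def)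
  qed
  show "g x = q x" if "0 \<le> x" for x
    using g_diff[of x 0] that q0 by simp
  have g_add: "g (x + y) = g x + g y" for x y
  proof -
    have "x + y = (pprt x + pprt y) - (pprt (- x) + pprt (- y))"
      by (subst pos_part_diff[of x], subst pos_part_diff[of y]) simp
    then show ?thesis
      using g_diff[of "pprt x + pprt y" "pprt (- x) + pprt (- y)"]
      by (simp add: add g_def)
  qed
  have g_scale_pos: "g (c *\<^sub>R x) = c * g x" if "0 < c" for c x
  proof -
    have "c *\<^sub>R x = c *\<^sub>R pprt x - c *\<^sub>R pprt (- x)"
      by (metis pos_part_diff scaleR_diff_right)
    then have "g (c *\<^sub>R x) = q (c *\<^sub>R pprt x) - q (c *\<^sub>R pprt (- x))"
      using that g_diff[of "c *\<^sub>R pprt x" "c *\<^sub>R pprt (- x)"] by (simp add: scaleR_nonneg_nonneg)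
    then show ?thesis
      using that by (simp add: scale g_def algebra_simps)
  qed
  have g_minus: "g (- x) = - g x" for x by (simp add: g_def)
  have g_scale: "g (c *\<^sub>R x) = c *\<^sub>R g x" for c x
    using g_scale_pos[of c x] g_scale_pos[of "- c" x] g_minus[of "c *\<^sub>R x"] q0
    by (cases c "0::real" rule: linorder_cases) (auto simp: g_def)
  show "bounded_linear g"
  proof (rule bounded_linear_intro[OF g_add g_scale])
    fix x
    have "\<bar>g x\<bar> \<le> \<bar>C\<bar> * norm (pprt x) + \<bar>C\<bar> * norm (pprt (- x))"
    proof -
      have *: "\<bar>q a\<bar> \<le> \<bar>C\<bar> * norm a" if "0 \<le> a" for a
        using bound[OF that] mult_right_mono[OF abs_ge_self[of C], of "norm a"] by simp
      show ?thesis
        using *[of "pprt x"] *[of "pprt (- x)"] by (simp add: g_def)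
    qed
    also have "\<dots> \<le> \<bar>C\<bar> * norm x + \<bar>C\<bar> * norm x"
      using norm_pprt_le[of x] norm_pprt_le[of "- x"] by (intro add_mono mult_left_mono) auto
    finally show "norm (g x) \<le> norm x * (2 * \<bar>C\<bar>)" by (simp add: algebra_simps)
  qed
qed

text \<open>Riesz--Kantorovich formula for the positive part of a functional; as the supremum runs over
  an ideal, it also extends that positive part to the whole lattice.\<close>

lemma riesz_kantorovich_extension:
  fixes h :: "'a::banach_lattice \<Rightarrow> real"
  assumes J: "ideal J"
    and add: "\<And>x y. x \<in> J \<Longrightarrow> y \<in> J \<Longrightarrow> h (x + y) = h x + h y"
    and scale: "\<And>c x. x \<in> J \<Longrightarrow> h (c *\<^sub>R x) = c * h x"
    and bound: "\<And>x. x \<in> J \<Longrightarrow> \<bar>h x\<bar> \<le> C * norm x"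
  obtains g where "bounded_linear g"
    "\<And>x y. y \<in> J \<Longrightarrow> 0 \<le> y \<Longrightarrow> y \<le> x \<Longrightarrow> h y \<le> g x"
    "\<And>x u. 0 \<le> x \<Longrightarrow> (\<And>y. y \<in> J \<Longrightarrow> 0 \<le> y \<Longrightarrow> y \<le> x \<Longrightarrow> h y \<le> u) \<Longrightarrow> g x \<le> u"
proof -
  have sub: "subspace J" using J by (simp add: ideal_def)
  have solid: "z \<in> J" if "0 \<le> z" "z \<le> y" "y \<in> J" for y z
    using J that by (metis abs_of_nonneg ideal_def order_trans)
  have J0: "0 \<in> J" by (rule subspace_0[OF sub])
  have h0: "h 0 = 0" using add[OF J0 J0] by simp
  define S where "S x = {y \<in> J. 0 \<le> y \<and> y \<le> x}" for x
  define q where "q x = (SUP y\<in>S x. h y)" for x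
  have ne: "S x \<noteq> {}" if "0 \<le> x" for x
    using that J0 by (auto simp: S_def)
  have h_le: "h y \<le> \<bar>C\<bar> * norm x" if "y \<in> S x" for x y
  proof -
    have y: "y \<in> J" "0 \<le> y" "y \<le> x" using that by (auto simp: S_def)
    then have "norm y \<le> norm x" by (intro norm_mono_abs) simp
    then have "C * norm y \<le> \<bar>C\<bar> * norm x" by (intro mult_mono) auto
    then show ?thesis using bound[OF y(1)] by simp
  qed
  have bdd: "bdd_above (h ` S x)" for x
    by (rule bdd_aboveI2[where M = "\<bar>C\<bar> * norm x"]) (rule h_le)
  have upper: "h y \<le> q x" if "y \<in> S x" for x y
    unfolding q_def using that bdd by (rule cSUP_upper)
  have least: "q x \<le> u" if "0 \<le> x" "\<And>y. y \<in> S x \<Longrightarrow> h y \<le> u" for x u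
    unfolding q_def using ne[OF that(1)] that(2) by (rule cSUP_least)
  have q_add: "q (x + y) = q x + q y" if x: "0 \<le> x" and y: "0 \<le> y" for x y
  proof (rule antisym)
    show "q (x + y) \<le> q x + q y"
    proof (rule least)
      fix z assume z: "z \<in> S (x + y)"
      then obtain u v where uv: "z = u + v" "0 \<le> u" "u \<le> x" "0 \<le> v" "v \<le> y"
        using riesz_decomposition[of z x y] x y by (auto simp: S_def)
      \<comment> \<open>Both pieces lie below \<open>z\<close>, which is in \<open>J\<close>, and
        \<open>J\<close> is solid.\<close>
      have "u \<in> J" "v \<in> J"
        using z uv by (auto simp: S_def intro!: solid[of _ "u + v"])
      then show "h z \<le> q x + q y"
        using uv add[of u v] upper[of u x] upper[of v y] by (simp add: S_def)
    qed (use x y in simp)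
    have "h u + h v \<le> q (x + y)" if "u \<in> S x" "v \<in> S y" for u v
    proof -
      have "u + v \<in> S (x + y)"
        using that sub by (auto simp: S_def add_mono subspace_add)
      then show ?thesis using upper[of "u + v"] add[of u v] that by (simp add: S_def)
    qed
    then have "q x \<le> q (x + y) - h v" if "v \<in> S y" for v
      using that x by (intro least) (auto simp: algebra_simps)
    then have "q y \<le> q (x + y) - q x"
      using y by (intro least) (auto simp: algebra_simps)
    then show "q x + q y \<le> q (x + y)" by simp
  qed
  have q_scale_le: "c * q x \<le> q (c *\<^sub>R x)" if c: "0 < c" and x: "0 \<le> x" for c x
  proof -
    have "h y \<le> q (c *\<^sub>R x) / c" if "y \<in> S x" for y
    proof -
      have "c *\<^sub>R y \<in> S (c *\<^sub>R x)"
        using that c sub by (auto simp: S_def subspace_scale scaleR_nonneg_nonneg scaleR_left_mono)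
      then have "c * h y \<le> q (c *\<^sub>R x)"
        using upper[of "c *\<^sub>R y"] scale[of y c] that by (simp add: S_def)
      then show ?thesis using c by (simp add: pos_le_divide_eq mult.commute)
    qed
    then have "q x \<le> q (c *\<^sub>R x) / c" by (rule least[OF x])
    then show ?thesis using c by (simp add: pos_le_divide_eq mult.commute)
  qed
  have q_scale: "q (c *\<^sub>R x) = c * q x" if c: "0 < c" and x: "0 \<le> x" for c x
  proof (rule antisym[OF _ q_scale_le[OF that]])
    \<comment> \<open>The reverse inequality is the one already proved, for the factor
      \<open>1 / c\<close> and the vector \<open>c *\<^sub>R x\<close>.\<close>
    have "(1 / c) * q (c *\<^sub>R x) \<le> q ((1 / c) *\<^sub>R c *\<^sub>R x)"
      using c x by (intro q_scale_le) (auto simp: scaleR_nonneg_nonneg)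
    then show "q (c *\<^sub>R x) \<le> c * q x"
      using c by (simp add: pos_divide_le_eq mult.commute)
  qed
  have q_bound: "\<bar>q x\<bar> \<le> \<bar>C\<bar> * norm x" if "0 \<le> x" for x
    using least[OF that h_le] upper[of 0 x] that h0 J0 by (simp add: S_def)
  obtain g where g: "bounded_linear g" "\<And>x. 0 \<le> x \<Longrightarrow> g x = q x"
    using bounded_linear_of_pos_additive[of q, OF q_add q_scale q_bound] by blast
  show thesis
  proof (rule that[OF g(1)])
    show "h y \<le> g x" if "y \<in> J" "0 \<le> y" "y \<le> x" for x y
      using upper[of y x] g(2)[of x] that by (simp add: S_def order_trans[of 0 y x])
    show "g x \<le> u" if "0 \<le> x" "\<And>y. y \<in> J \<Longrightarrow> 0 \<le> y \<Longrightarrow> y \<le> x \<Longrightarrow> h y \<le> u" for x u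
      using least[of x u] g(2)[of x] that by (simp add: S_def)
  qed
qed

text \<open>The functional \<open>p\<close> is the sum of the extended positive parts of
  \<open>h\<close> and of \<open>- h\<close>; on the ideal it is the modulus of
  \<open>h\<close>.\<close>

lemma ex_positive_dominating_functional:
  fixes h :: "'a::banach_lattice \<Rightarrow> real"
  assumes J: "ideal J"
    and add: "\<And>x y. x \<in> J \<Longrightarrow> y \<in> J \<Longrightarrow> h (x + y) = h x + h y"
    and scale: "\<And>c x. x \<in> J \<Longrightarrow> h (c *\<^sub>R x) = c * h x"
    and bound: "\<And>x. x \<in> J \<Longrightarrow> \<bar>h x\<bar> \<le> C * norm x"
  obtains p where "bounded_linear p" "\<And>x. 0 \<le> x \<Longrightarrow> 0 \<le> p x" "\<And>y. y \<in> J \<Longrightarrow> \<bar>h y\<bar> \<le> p \<bar>y\<bar>"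
proof -
  have sub: "subspace J" using J by (simp add: ideal_def)
  have J0: "0 \<in> J" by (rule subspace_0[OF sub])
  have h0: "h 0 = 0" using add[OF J0 J0] by simp
  obtain g where g: "bounded_linear g" "\<And>x y. y \<in> J \<Longrightarrow> 0 \<le> y \<Longrightarrow> y \<le> x \<Longrightarrow> h y \<le> g x"
    using riesz_kantorovich_extension[OF assms] by metis
  obtain g' where g': "bounded_linear g'" "\<And>x y. y \<in> J \<Longrightarrow> 0 \<le> y \<Longrightarrow> y \<le> x \<Longrightarrow> - h y \<le> g' x"
    by (rule riesz_kantorovich_extension[OF J, of "\<lambda>x. - h x" C]) (simp_all add: add scale bound)
  show thesis
  proof (rule that[of "\<lambda>x. g x + g' x"])
    show "bounded_linear (\<lambda>x. g x + g' x)" using g(1) g'(1) by (rule bounded_linear_add)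
    show nn: "0 \<le> g x + g' x" if "0 \<le> x" for x
      using g(2)[OF J0 order_refl that] g'(2)[OF J0 order_refl that] by (simp add: h0)
    show "\<bar>h y\<bar> \<le> g \<bar>y\<bar> + g' \<bar>y\<bar>" if y: "y \<in> J" for y
    proof -
      have solid: "z \<in> J" if "\<bar>z\<bar> \<le> \<bar>y\<bar>" for z
        using J y that unfolding ideal_def by blast
      have pp: "pprt y \<in> J" "pprt (- y) \<in> J"
        using pprt_le_abs[of y] pprt_le_abs[of "- y"] by (simp_all add: solid)
      \<comment> \<open>Here \<open>g z\<close> dominates \<open>h z\<close>, \<open>g' z\<close>
        dominates \<open>- h z\<close>, and both are nonnegative because 0 is admissible in the
        suprema.\<close>
      have pos: "\<bar>h z\<bar> \<le> g z + g' z" if "z \<in> J" "0 \<le> z" for z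
        using g(2)[OF that order_refl] g'(2)[OF that order_refl]
          g(2)[OF J0 order_refl that(2)] g'(2)[OF J0 order_refl that(2)] by (simp add: h0)
      have "h y = h (pprt y) + h ((-1) *\<^sub>R pprt (- y))"
        using add[of "pprt y" "(-1) *\<^sub>R pprt (- y)"] pos_part_diff[of y] pp sub
        by (simp add: subspace_neg)
      also have "\<dots> = h (pprt y) - h (pprt (- y))" using scale[of "pprt (- y)" "-1"] pp by simp
      finally have "\<bar>h y\<bar> \<le> \<bar>h (pprt y)\<bar> + \<bar>h (pprt (- y))\<bar>" by (simp only: abs_triangle_ineq4)
      also have "\<dots> \<le> (g (pprt y) + g' (pprt y)) + (g (pprt (- y)) + g' (pprt (- y)))"
        using pos[OF pp(1) zero_le_pprt] pos[OF pp(2) zero_le_pprt] by (rule add_mono)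
      also have "\<dots> = g \<bar>y\<bar> + g' \<bar>y\<bar>"
        using linear_add[OF bounded_linear.linear[OF g(1)], of "pprt y" "pprt (- y)"]
          linear_add[OF bounded_linear.linear[OF g'(1)], of "pprt y" "pprt (- y)"]
        by (simp only: abs_pos_part[of y] ac_simps)
      finally show ?thesis .
    qed
  qed
qed

section \<open>Absolute values of a disjoint weakly null sequence\<close>

text \<open>Sums stay in the set by \<open>inf_add_le\<close>. Scalar multiples are reduced to
  natural multiples, which are repeated sums, through solidity and
  \<open>\<bar>c\<bar> \<le> real n\<close>.\<close>

lemma ideal_disjoint_complement:
  assumes nonneg: "\<And>z. z \<in> Z \<Longrightarrow> 0 \<le> z"
  shows "ideal {y :: 'a::banach_lattice. \<forall>z\<in>Z. inf \<bar>y\<bar> z = 0}"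
proof -
  let ?J = "{y. \<forall>z\<in>Z. inf \<bar>y\<bar> z = 0}"
  have solid: "x \<in> ?J" if y: "y \<in> ?J" and xy: "\<bar>x\<bar> \<le> \<bar>y\<bar>" for x y
  proof -
    have "inf \<bar>x\<bar> z = 0" if z: "z \<in> Z" for z
    proof (rule antisym)
      have "inf \<bar>x\<bar> z \<le> inf \<bar>y\<bar> z" using xy by (rule inf_mono) simp
      also have "\<dots> = 0" using y z by simp
      finally show "inf \<bar>x\<bar> z \<le> 0" .
    qed (use nonneg z in simp)
    then show ?thesis by simp
  qed
  have add: "x + y \<in> ?J" if "x \<in> ?J" "y \<in> ?J" for x y
  proof -
    have "inf \<bar>x + y\<bar> z = 0" if z: "z \<in> Z" for z
    proof (rule antisym)
      have "inf \<bar>x + y\<bar> z \<le> inf (\<bar>x\<bar> + \<bar>y\<bar>) z" by (rule inf_mono[OF abs_triangle_ineq order_refl])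
      also have "\<dots> \<le> inf \<bar>x\<bar> z + inf \<bar>y\<bar> z" using nonneg z by (intro inf_add_le) auto
      finally show "inf \<bar>x + y\<bar> z \<le> 0" using \<open>x \<in> ?J\<close> \<open>y \<in> ?J\<close> z by simp
    qed (use nonneg z in simp)
    then show ?thesis by simp
  qed
  have zero: "0 \<in> ?J" using nonneg by (simp add: inf_absorb1)
  have mult: "real n *\<^sub>R x \<in> ?J" if "x \<in> ?J" for n x
    by (induction n) (use zero add that in \<open>auto simp: scaleR_add_left simp del: mem_Collect_eq\<close>)
  have scale: "c *\<^sub>R x \<in> ?J" if x: "x \<in> ?J" for c x
  proof -
    obtain n where n: "\<bar>c\<bar> \<le> real n" using real_arch_simple by blast
    have "\<bar>c *\<^sub>R x\<bar> \<le> \<bar>real n *\<^sub>R \<bar>x\<bar>\<bar>"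
    proof -
      have le: "d *\<^sub>R y \<le> real n *\<^sub>R \<bar>x\<bar>" if "0 \<le> d" "d \<le> real n" "y \<le> \<bar>x\<bar>" for d y
        using that by (meson abs_ge_zero order_trans scaleR_left_mono scaleR_right_mono)
      have "c *\<^sub>R x \<le> real n *\<^sub>R \<bar>x\<bar>" "- (c *\<^sub>R x) \<le> real n *\<^sub>R \<bar>x\<bar>"
        using le[of c x] le[of "- c" "- x"] le[of c "- x"] le[of "- c" x] n
        by (cases "0 \<le> c"; simp add: abs_ge_minus_self abs_ge_self abs_le_iff)+
      then show ?thesis by (simp add: scaleR_nonneg_nonneg abs_le_iff)
    qed
    moreover have "real n *\<^sub>R \<bar>x\<bar> \<in> ?J" using x by (intro mult) simp
    ultimately show ?thesis using solid by blast
  qed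
  show ?thesis
    unfolding ideal_def subspace_def using zero add scale solid by blast
qed

text \<open>On the band of vectors disjoint from every \<open>pprt (- x m)\<close>, the functional \<open>p\<close> extends to one
  that agrees with \<open>p\<close> on \<open>pprt (x n)\<close> and vanishes on \<open>pprt (- x n)\<close>; evaluated at \<open>x n\<close> it
  therefore gives \<open>p (pprt (x n))\<close>.\<close>

lemma ex_positive_part_selector:
  fixes p :: "'a::banach_lattice \<Rightarrow> real"
  assumes p: "bounded_linear p" "\<And>x. 0 \<le> x \<Longrightarrow> 0 \<le> p x"
    and disj: "\<And>m n. m \<noteq> n \<Longrightarrow> inf \<bar>x m\<bar> \<bar>x n\<bar> = 0"
  shows "\<exists>g. bounded_linear g \<and> (\<forall>n. g (x n) = p (pprt (x n)))"
proof -
  define J where "J = {y. \<forall>z\<in>range (\<lambda>m. pprt (- x m)). inf \<bar>y\<bar> z = 0}"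
  have J: "ideal J" unfolding J_def by (rule ideal_disjoint_complement) auto
  have mono: "p y \<le> p z" if "y \<le> z" for y z
    using p(2)[of "z - y"] that p(1) by (simp add: linear_diff bounded_linear.linear)
  have mem: "pprt (x n) \<in> J" for n
  proof -
    have "inf (pprt (x n)) (pprt (- x m)) = 0" for m
    proof (cases "m = n")
      case False
      have "inf (pprt (x n)) (pprt (- x m)) \<le> inf \<bar>x n\<bar> \<bar>x m\<bar>"
        using pprt_le_abs[of "x n"] pprt_le_abs[of "- x m"] by (intro inf_mono) auto
      then have "inf (pprt (x n)) (pprt (- x m)) \<le> 0"
        using disj[of n m] False by simp
      then show ?thesis by (intro antisym) auto
    qed (simp add: inf_pprt_minus)
    then show ?thesis by (simp add: J_def)
  qed
  obtain C where "\<And>y. norm (p y) \<le> norm y * C" using bounded_linear.bounded[OF p(1)] by blast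
  then have C: "\<bar>p y\<bar> \<le> C * norm y" for y by (simp add: mult.commute)
  obtain g where g: "bounded_linear g"
    and lower: "\<And>x y. y \<in> J \<Longrightarrow> 0 \<le> y \<Longrightarrow> y \<le> x \<Longrightarrow> p y \<le> g x"
    and upper: "\<And>x u. 0 \<le> x \<Longrightarrow> (\<And>y. y \<in> J \<Longrightarrow> 0 \<le> y \<Longrightarrow> y \<le> x \<Longrightarrow> p y \<le> u) \<Longrightarrow> g x \<le> u"
    by (rule riesz_kantorovich_extension[OF J, of p C])
      (simp_all add: C linear_add[OF bounded_linear.linear[OF p(1)]] linear_cmul[OF bounded_linear.linear[OF p(1)]])
  have p0: "p 0 = 0" by (rule linear_0[OF bounded_linear.linear[OF p(1)]])
  have "g (x n) = p (pprt (x n))" for n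
  proof -
    have "g (pprt (x n)) = p (pprt (x n))"
      using mono by (intro antisym upper lower mem) auto
    moreover have "g (pprt (- x n)) = 0"
    proof (rule antisym)
      show "g (pprt (- x n)) \<le> 0"
      proof (rule upper)
        \<comment> \<open>A member of \<open>J\<close> below \<open>pprt (- x n)\<close> is also
          disjoint from it, hence zero.\<close>
        fix y assume y: "y \<in> J" "0 \<le> y" "y \<le> pprt (- x n)"
        then have "y = inf \<bar>y\<bar> (pprt (- x n))" by (simp add: inf_absorb1)
        then have "y = 0" using y(1) by (simp add: J_def)
        then show "p y \<le> 0" using p0 by simp
      qed simp
      show "0 \<le> g (pprt (- x n))"
        using lower[of 0 "pprt (- x n)"] J p0 by (simp add: ideal_def subspace_0)
    qed
    moreover have "g (x n) = g (pprt (x n)) - g (pprt (- x n))"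
      by (metis g linear_diff bounded_linear.linear pos_part_diff)
    ultimately show ?thesis by simp
  qed
  then show ?thesis using g by blast
qed

text \<open>Selectors for the sequences \<open>x\<close> and \<open>- x\<close> recover
  \<open>p\<close> of the positive and negative parts, so \<open>p \<bar>x n\<bar>\<close> is the
  difference of two fixed functionals evaluated at \<open>x n\<close>.\<close>

lemma tendsto_positive_functional_abs:
  fixes p :: "'a::banach_lattice \<Rightarrow> real"
  assumes p: "bounded_linear p" "\<And>x. 0 \<le> x \<Longrightarrow> 0 \<le> p x"
    and disj: "\<And>m n. m \<noteq> n \<Longrightarrow> inf \<bar>x m\<bar> \<bar>x n\<bar> = 0"
    and weak: "\<And>g. bounded_linear g \<Longrightarrow> (\<lambda>n. g (x n) :: real) \<longlonglongrightarrow> 0"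
  shows "(\<lambda>n. p \<bar>x n\<bar>) \<longlonglongrightarrow> 0"
proof -
  obtain g where g: "bounded_linear g" "\<And>n. g (x n) = p (pprt (x n))"
    using ex_positive_part_selector[where x = x, OF p disj] by auto
  have "inf \<bar>- x m\<bar> \<bar>- x n\<bar> = 0" if "m \<noteq> n" for m n
    using disj[OF that] by simp
  then obtain g' where g': "bounded_linear g'" "\<And>n. g' (- x n) = p (pprt (- x n))"
    using ex_positive_part_selector[where x = "\<lambda>n. - x n", OF p] by auto
  have "p \<bar>x n\<bar> = g (x n) - g' (x n)" for n
    using g(2)[of n] g'(2)[of n] linear_neg[OF bounded_linear.linear[OF g'(1)], of "x n"]
      linear_add[OF bounded_linear.linear[OF p(1)], of "pprt (x n)" "pprt (- x n)"]
    unfolding abs_pos_part[of "x n"] by linarith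
  then show ?thesis
    using tendsto_diff[OF weak[OF g(1)] weak[OF g'(1)]] by simp
qed

section \<open>Ideals as Banach lattice structures\<close>

lemma sublattice_simps [simp]:
  "vcarrier (sublattice S) = S" "vadd (sublattice S) = (+)" "vzero (sublattice S) = 0"
  "vscale (sublattice S) = (*\<^sub>R)" "vnorm (sublattice S) = norm" "vle (sublattice S) = (\<le>)"
  by (simp_all add: sublattice_def)

lemma bounded_linear_map_sublattice_real:
  "bounded_linear_map (sublattice S) real_line f \<longleftrightarrow>
     (\<forall>x\<in>S. \<forall>y\<in>S. f (x + y) = f x + f y) \<and> (\<forall>c. \<forall>x\<in>S. f (c *\<^sub>R x) = c * f x) \<and>
     (\<exists>C. \<forall>x\<in>S. \<bar>f x\<bar> \<le> C * norm x)"
  by (simp add: bounded_linear_map_def real_line_def)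

lemma ideal_abs: "ideal S \<Longrightarrow> x \<in> S \<Longrightarrow> \<bar>x\<bar> \<in> S"
  unfolding ideal_def by (metis abs_idempotent order_refl)

lemma vabs_sublattice:
  assumes S: "ideal S" and x: "x \<in> S"
  shows "vabs (sublattice S) x = \<bar>x\<bar>"
  unfolding vabs_def
proof (rule the_equality)
  show "is_vsup (sublattice S) x (vscale (sublattice S) (- 1) x) \<bar>x\<bar>"
    using ideal_abs[OF S x] by (simp add: is_vsup_def abs_le_iff abs_ge_minus_self abs_ge_self)
  then show "s = \<bar>x\<bar>" if "is_vsup (sublattice S) x (vscale (sublattice S) (- 1) x) s" for s
    using that by (auto simp: is_vsup_def intro: antisym)
qed

lemma disjoint_vectors_sublattice:
  assumes S: "ideal S" and x: "x \<in> S" and y: "y \<in> S"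
  shows "disjoint_vectors (sublattice S) x y \<longleftrightarrow> inf \<bar>x\<bar> \<bar>y\<bar> = 0"
proof
  \<comment> \<open>By solidity the infimum taken in the whole lattice lies in \<open>S\<close>, so
    it can be tested against the lower bounds within \<open>S\<close>.\<close>
  have inf: "inf \<bar>x\<bar> \<bar>y\<bar> \<in> S"
  proof -
    have "\<bar>inf \<bar>x\<bar> \<bar>y\<bar>\<bar> \<le> \<bar>x\<bar>" by simp
    then show ?thesis using S x unfolding ideal_def by blast
  qed
  assume "disjoint_vectors (sublattice S) x y"
  then have "\<forall>t\<in>S. t \<le> \<bar>x\<bar> \<and> t \<le> \<bar>y\<bar> \<longrightarrow> t \<le> 0"
    unfolding disjoint_vectors_def is_vinf_def vabs_sublattice[OF S x] vabs_sublattice[OF S y] sublattice_simps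
    by blast
  then have "inf \<bar>x\<bar> \<bar>y\<bar> \<le> 0" using inf by (meson inf_le1 inf_le2)
  then show "inf \<bar>x\<bar> \<bar>y\<bar> = 0" by (intro antisym le_infI abs_ge_zero)
next
  assume "inf \<bar>x\<bar> \<bar>y\<bar> = 0"
  then have "t \<le> 0" if "t \<le> \<bar>x\<bar>" "t \<le> \<bar>y\<bar>" for t
    using that by (metis le_inf_iff)
  moreover have "0 \<in> S" "0 \<le> \<bar>x\<bar>" "0 \<le> \<bar>y\<bar>" using S by (simp_all add: ideal_def subspace_0)
  ultimately show "disjoint_vectors (sublattice S) x y"
    unfolding disjoint_vectors_def is_vinf_def vabs_sublattice[OF S x] vabs_sublattice[OF S y] sublattice_simps
    by blast
qed

text \<open>A functional \<open>h\<close> on \<open>J\<close> is dominated by a positive functional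
  \<open>p\<close> on the whole lattice, so \<open>\<bar>h (y n)\<bar> \<le> p \<bar>y n\<bar> \<le>
  p \<bar>x n\<bar>\<close>, which tends to 0. It serves both for \<open>\<bar>x n\<bar>\<close> in
  the whole lattice and for the approximants in \<open>I\<close>.\<close>

lemma weakly_null_of_dominated_disjoint:
  fixes x y :: "nat \<Rightarrow> 'a::banach_lattice"
  assumes J: "ideal J" and yJ: "range y \<subseteq> J"
    and x: "weakly_null (sublattice UNIV) x"
    and disj: "\<And>m n. m \<noteq> n \<Longrightarrow> inf \<bar>x m\<bar> \<bar>x n\<bar> = 0"
    and le: "\<And>n. \<bar>y n\<bar> \<le> \<bar>x n\<bar>"
  shows "weakly_null (sublattice J) y"
proof -
  have J0: "0 \<in> J" using J by (simp add: ideal_def subspace_0)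
  have weak: "(\<lambda>n. g (x n)) \<longlonglongrightarrow> 0" if g: "bounded_linear g" for g :: "'a \<Rightarrow> real"
  proof -
    obtain C where "\<And>y. norm (g y) \<le> norm y * C" using bounded_linear.bounded[OF g] by blast
    then have "bounded_linear_map (sublattice UNIV) real_line g"
      using linear_add[OF bounded_linear.linear[OF g]] linear_cmul[OF bounded_linear.linear[OF g]]
      unfolding bounded_linear_map_sublattice_real by (auto simp: mult.commute intro!: exI[of _ C])
    then have "(\<lambda>n. g (x n)) \<longlonglongrightarrow> g 0"
      using x by (simp add: weakly_null_iff)
    then show ?thesis
      using linear_0[OF bounded_linear.linear[OF g]] by simp
  qed
  have "(\<lambda>n. h (y n)) \<longlonglongrightarrow> h 0" if h: "bounded_linear_map (sublattice J) real_line h" for h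
  proof -
    have add: "\<And>x y. x \<in> J \<Longrightarrow> y \<in> J \<Longrightarrow> h (x + y) = h x + h y"
      and scale: "\<And>c x. x \<in> J \<Longrightarrow> h (c *\<^sub>R x) = c * h x"
      using h by (simp_all add: bounded_linear_map_sublattice_real)
    obtain C where bound: "\<And>x. x \<in> J \<Longrightarrow> \<bar>h x\<bar> \<le> C * norm x"
      using h unfolding bounded_linear_map_sublattice_real by blast
    obtain p where p: "bounded_linear p" "\<And>x. 0 \<le> x \<Longrightarrow> 0 \<le> p x" "\<And>y. y \<in> J \<Longrightarrow> \<bar>h y\<bar> \<le> p \<bar>y\<bar>"
      using ex_positive_dominating_functional[OF J add scale bound] by blast
    have "\<bar>h (y n)\<bar> \<le> p \<bar>x n\<bar>" for n
    proof -
      have "p \<bar>y n\<bar> \<le> p \<bar>x n\<bar>"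
        using p(2)[of "\<bar>x n\<bar> - \<bar>y n\<bar>"] le[of n] linear_diff[OF bounded_linear.linear[OF p(1)], of "\<bar>x n\<bar>" "\<bar>y n\<bar>"]
        by simp
      then show ?thesis using p(3)[of "y n"] yJ by (simp add: range_subsetD)
    qed
    then have "(\<lambda>n. h (y n)) \<longlonglongrightarrow> 0"
      by (intro Lim_null_comparison[OF _ tendsto_positive_functional_abs[where x = x, OF p(1,2) disj weak]])
        (auto intro: always_eventually)
    moreover have "h 0 = 0" using add[OF J0 J0] by simp
    ultimately show ?thesis by simp
  qed
  then show ?thesis using yJ J0 by (simp add: weakly_null_iff)
qed

lemma ideal_UNIV: "ideal UNIV"
  by (simp add: ideal_def)

text \<open>The ball of \<open>S\<close> is part of the whole ball, so the closure of its image is a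
  closed subset of a compact set.\<close>

lemma weakly_compact_operator_restrict:
  assumes "weakly_compact_operator (sublattice UNIV) F T"
  shows "weakly_compact_operator (sublattice S) F T"
proof -
  have "compactin (weak_topology F) (weak_topology F closure_of (T ` {x. norm x \<le> 1}))"
    using assms by (simp add: weakly_compact_operator_def)
  then have "compactin (weak_topology F) (weak_topology F closure_of (T ` {x \<in> S. norm x \<le> 1}))"
    by (rule closed_compactin) (auto intro!: closure_of_mono)
  moreover have "bounded_linear_map (sublattice S) F T"
    using assms by (auto simp: weakly_compact_operator_def bounded_linear_map_def)
  ultimately show ?thesis by (simp add: weakly_compact_operator_def)
qed

section \<open>The quotient by an ideal\<close>

text \<open>The quotient map, in the form in which the carrier of \<open>quotient_lattice\<close> is
  written.\<close>

definition coset :: "'a::banach_lattice set \<Rightarrow> 'a \<Rightarrow> 'a set" where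
  "coset I x = {x + y | y. y \<in> I}"

context
  fixes I :: "'a::banach_lattice set"
  assumes I: "subspace I"
begin

lemma mem_coset: "a \<in> coset I x \<longleftrightarrow> a - x \<in> I"
  by (force simp: coset_def)

lemma self_mem_coset: "x \<in> coset I x"
  by (simp add: mem_coset subspace_0[OF I])

lemma coset_zero: "coset I 0 = I"
  by (simp add: coset_def)

lemma vadd_coset: "vadd (quotient_lattice I) (coset I x) (coset I y) = coset I (x + y)"
proof -
  have "{a + b |a b. a \<in> coset I x \<and> b \<in> coset I y} = coset I (x + y)"
  proof safe
    fix a b assume "a \<in> coset I x" "b \<in> coset I y"
    then have "(a - x) + (b - y) \<in> I" by (simp only: mem_coset subspace_add[OF I])
    then show "a + b \<in> coset I (x + y)" by (simp add: mem_coset algebra_simps)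
  next
    fix c assume "c \<in> coset I (x + y)"
    then have "c - y \<in> coset I x" by (simp add: mem_coset algebra_simps)
    then show "\<exists>a b. c = a + b \<and> a \<in> coset I x \<and> b \<in> coset I y"
      using self_mem_coset by (metis diff_add_cancel)
  qed
  then show ?thesis by (simp add: quotient_lattice_def)
qed

lemma vscale_coset: "vscale (quotient_lattice I) c (coset I x) = coset I (c *\<^sub>R x)"
proof -
  have "{c *\<^sub>R a + y |a y. a \<in> coset I x \<and> y \<in> I} = coset I (c *\<^sub>R x)"
  proof safe
    fix a y assume "a \<in> coset I x" "y \<in> I"
    then have "c *\<^sub>R (a - x) + y \<in> I" by (simp add: mem_coset subspace_add[OF I] subspace_scale[OF I])
    then show "c *\<^sub>R a + y \<in> coset I (c *\<^sub>R x)" by (simp add: mem_coset algebra_simps)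
  next
    fix d assume "d \<in> coset I (c *\<^sub>R x)"
    then show "\<exists>a y. d = c *\<^sub>R a + y \<and> a \<in> coset I x \<and> y \<in> I"
      using self_mem_coset by (intro exI[of _ x] exI[of _ "d - c *\<^sub>R x"]) (simp add: mem_coset)
  qed
  then show ?thesis by (simp add: quotient_lattice_def)
qed

lemma vcarrier_quotient: "vcarrier (quotient_lattice I) = range (coset I)"
  by (simp add: quotient_lattice_def coset_def)

lemma vnorm_quotient: "vnorm (quotient_lattice I) A = (INF a\<in>A. norm a)"
  by (simp add: quotient_lattice_def)

lemma bdd_below_norm: "bdd_below (norm ` (A :: 'a set))"
  by (rule bdd_belowI2[where m = 0]) simp

lemma vnorm_coset_le: "vnorm (quotient_lattice I) (coset I x) \<le> norm x"
  unfolding vnorm_quotient by (rule cINF_lower[OF bdd_below_norm self_mem_coset])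

lemma vnorm_coset_nonneg: "0 \<le> vnorm (quotient_lattice I) (coset I x)"
  unfolding vnorm_quotient using self_mem_coset[of x] by (intro cINF_greatest) auto

lemma ex_mem_coset_norm_less:
  assumes "0 < \<epsilon>"
  obtains a where "a \<in> coset I x" "norm a < vnorm (quotient_lattice I) (coset I x) + \<epsilon>"
proof -
  have "coset I x \<noteq> {}" using self_mem_coset by blast
  moreover have "(INF a\<in>coset I x. norm a) < vnorm (quotient_lattice I) (coset I x) + \<epsilon>"
    unfolding vnorm_quotient using assms by simp
  ultimately show thesis
    using that by (auto simp: cINF_less_iff[OF _ bdd_below_norm])
qed

lemma bounded_linear_map_coset: "bounded_linear_map (sublattice UNIV) (quotient_lattice I) (coset I)"
  unfolding bounded_linear_map_def
  by (auto simp: vcarrier_quotient vadd_coset vscale_coset vnorm_coset_le intro!: exI[of _ 1])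

lemma vle_zero_coset: "0 \<le> x \<Longrightarrow> vle (quotient_lattice I) (vzero (quotient_lattice I)) (coset I x)"
  using self_mem_coset[of x] subspace_0[OF I] by (auto simp: quotient_lattice_def)

end

section \<open>Approximation of disjoint sequences from within the ideal\<close>

text \<open>Both parts of \<open>x\<close> are truncated at \<open>\<bar>i\<bar>\<close>, and
  \<open>y\<close> is the difference of the truncations. Each remainder is at most
  \<open>\<bar>\<bar>x\<bar> + i\<bar>\<close>, which accounts for the factor 2; the estimate is of
  use when \<open>\<bar>x\<bar> + i\<close> is a representative of small norm.\<close>

lemma ex_dominated_approximation:
  assumes I: "ideal I" and i: "i \<in> I"
  obtains y where "y \<in> I" "\<bar>y\<bar> \<le> \<bar>x\<bar>" "norm (x - y) \<le> 2 * norm (\<bar>x\<bar> + i)"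
proof -
  define u v where "u = inf (pprt x) \<bar>i\<bar>" and "v = inf (pprt (- x)) \<bar>i\<bar>"
  have uv0: "0 \<le> u" "0 \<le> v" by (simp_all add: u_def v_def)
  have solid: "z \<in> I" if "0 \<le> z" "z \<le> \<bar>i\<bar>" for z
    using I i that unfolding ideal_def by (metis abs_of_nonneg)
  have "u \<in> I" "v \<in> I"
    using uv0 by (auto intro!: solid simp: u_def v_def)
  then have "u - v \<in> I" using I by (simp add: ideal_def subspace_diff)
  moreover have "\<bar>u - v\<bar> \<le> \<bar>x\<bar>"
  proof -
    have "\<bar>u - v\<bar> \<le> \<bar>u\<bar> + \<bar>v\<bar>" by (rule abs_triangle_ineq4)
    also have "\<dots> = u + v" using uv0 by simp
    also have "\<dots> \<le> pprt x + pprt (- x)" by (intro add_mono) (simp_all add: u_def v_def)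
    finally show ?thesis by (simp only: abs_pos_part)
  qed
  moreover have "norm (x - (u - v)) \<le> 2 * norm (\<bar>x\<bar> + i)"
  proof -
    have part: "norm (a - inf a \<bar>i\<bar>) \<le> norm (\<bar>x\<bar> + i)" if a: "0 \<le> a" "a \<le> \<bar>x\<bar>" for a
    proof (rule norm_mono_abs)
      have "\<bar>x\<bar> \<le> \<bar>\<bar>x\<bar> + i\<bar> + \<bar>i\<bar>"
        using abs_triangle_ineq4[of "\<bar>x\<bar> + i" i] by simp
      \<comment> \<open>Both entries dominate \<open>a\<close>, and the common summand can be taken
        out of the infimum.\<close>
      then have "a \<le> inf (\<bar>\<bar>x\<bar> + i\<bar> + a) (\<bar>\<bar>x\<bar> + i\<bar> + \<bar>i\<bar>)"
        using a by (auto intro: order_trans add_increasing)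
      then have "a \<le> \<bar>\<bar>x\<bar> + i\<bar> + inf a \<bar>i\<bar>" by (simp only: add_inf_distrib_left)
      then have "a - inf a \<bar>i\<bar> \<le> \<bar>\<bar>x\<bar> + i\<bar>" by (simp only: diff_le_eq)
      moreover have "0 \<le> a - inf a \<bar>i\<bar>" by (simp only: diff_ge_0_iff_ge inf_le1)
      ultimately show "\<bar>a - inf a \<bar>i\<bar>\<bar> \<le> \<bar>\<bar>x\<bar> + i\<bar>" by (simp only: abs_of_nonneg)
    qed
    have "x - (u - v) = (pprt x - u) - (pprt (- x) - v)"
      by (subst pos_part_diff[of x]) (simp only: algebra_simps)
    also have "norm \<dots> \<le> norm (pprt x - u) + norm (pprt (- x) - v)"
      by (rule norm_triangle_ineq4)
    also have "\<dots> \<le> norm (\<bar>x\<bar> + i) + norm (\<bar>x\<bar> + i)"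
      unfolding u_def v_def using pprt_le_abs[of x] pprt_le_abs[of "- x"]
      by (intro add_mono part) (simp_all only: zero_le_pprt abs_minus_cancel)
    finally show ?thesis by simp
  qed
  ultimately show thesis using that by blast
qed

text \<open>The positive Schur property applies to the cosets of \<open>\<bar>x n\<bar>\<close>,
  which are positive and weakly null; representatives of nearly minimal norm then feed the
  truncation.\<close>

lemma ex_ideal_approximation_of_disjoint:
  fixes I :: "'a::banach_lattice set"
  assumes I: "ideal I" and schur: "positive_schur (quotient_lattice I)"
    and x: "weakly_null (sublattice UNIV) x"
    and disj: "\<And>m n. m \<noteq> n \<Longrightarrow> inf \<bar>x m\<bar> \<bar>x n\<bar> = 0"
  obtains y where "range y \<subseteq> I" "\<And>n. \<bar>y n\<bar> \<le> \<bar>x n\<bar>" "(\<lambda>n. norm (x n - y n)) \<longlonglongrightarrow> 0"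
proof -
  have sub: "subspace I" using I by (simp add: ideal_def)
  let ?Q = "quotient_lattice I"
  have "weakly_null (sublattice UNIV) (\<lambda>n. \<bar>x n\<bar>)"
    by (rule weakly_null_of_dominated_disjoint[OF ideal_UNIV _ x disj]) simp_all
  then have "weakly_null ?Q (\<lambda>n. coset I \<bar>x n\<bar>)"
  proof (rule weakly_null_image[OF _ bounded_linear_map_coset[OF sub]])
    show "coset I (vzero (sublattice UNIV)) = vzero ?Q"
      by (simp add: coset_zero[OF sub] quotient_lattice_def)
    show "0 \<le> vnorm ?Q A" if "A \<in> vcarrier ?Q" for A
      using that vnorm_coset_nonneg[OF sub] unfolding vcarrier_quotient[OF sub] by blast
  qed simp_all
  moreover have "vle ?Q (vzero ?Q) (coset I \<bar>x n\<bar>)" for n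
    by (rule vle_zero_coset[OF sub abs_ge_zero])
  ultimately have "norm_null ?Q (\<lambda>n. coset I \<bar>x n\<bar>)"
    using schur unfolding positive_schur_def by blast
  then have null: "(\<lambda>n. vnorm ?Q (coset I \<bar>x n\<bar>)) \<longlonglongrightarrow> 0"
    by (simp add: norm_null_def)
  have "\<exists>y. y \<in> I \<and> \<bar>y\<bar> \<le> \<bar>x n\<bar> \<and>
      norm (x n - y) \<le> 2 * (vnorm ?Q (coset I \<bar>x n\<bar>) + inverse (real (Suc n)))" for n
  proof -
    \<comment> \<open>The infimum in the quotient norm may fail to be attained, hence a slack that
      tends to 0.\<close>
    obtain a where a: "a \<in> coset I \<bar>x n\<bar>"
      "norm a < vnorm ?Q (coset I \<bar>x n\<bar>) + inverse (real (Suc n))"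
      using ex_mem_coset_norm_less[OF sub, of "inverse (real (Suc n))" "\<bar>x n\<bar>"] by auto
    \<comment> \<open>With \<open>i = a - \<bar>x n\<bar>\<close> in \<open>I\<close>, the vector
      \<open>\<bar>x n\<bar> + i\<close> is the chosen representative \<open>a\<close>.\<close>
    obtain y where "y \<in> I" "\<bar>y\<bar> \<le> \<bar>x n\<bar>" "norm (x n - y) \<le> 2 * norm (\<bar>x n\<bar> + (a - \<bar>x n\<bar>))"
      using ex_dominated_approximation[OF I, of "a - \<bar>x n\<bar>" "x n"] a(1) mem_coset[OF sub] by metis
    then show ?thesis using a(2) by (intro exI[of _ y]) auto
  qed
  then obtain y where y: "\<And>n. y n \<in> I" "\<And>n. \<bar>y n\<bar> \<le> \<bar>x n\<bar>"
      "\<And>n. norm (x n - y n) \<le> 2 * (vnorm ?Q (coset I \<bar>x n\<bar>) + inverse (real (Suc n)))"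
    by metis
  have "(\<lambda>n. 2 * (vnorm ?Q (coset I \<bar>x n\<bar>) + inverse (real (Suc n)))) \<longlonglongrightarrow> 2 * (0 + 0)"
    by (intro tendsto_intros null LIMSEQ_inverse_real_of_nat)
  then have lim: "(\<lambda>n. 2 * (vnorm ?Q (coset I \<bar>x n\<bar>) + inverse (real (Suc n)))) \<longlonglongrightarrow> 0"
    by (simp only: add_0_left mult_zero_right)
  have "norm (norm (x n - y n)) \<le> 2 * (vnorm ?Q (coset I \<bar>x n\<bar>) + inverse (real (Suc n)))" for n
    using y(3)[of n] by simp
  then have "(\<lambda>n. norm (x n - y n)) \<longlonglongrightarrow> 0"
    by (intro Lim_null_comparison[OF _ lim] always_eventually allI)
  then show thesis using that y by blast
qed

theorem corollary3p3:
  fixes I :: "'a::banach_lattice set"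
  assumes "closed_ideal I"
    and "weak_dunford_pettis TYPE(nat \<Rightarrow> 'a) (sublattice I)"
    and "positive_schur (quotient_lattice I)"
  shows "weak_dunford_pettis TYPE('f) (sublattice (UNIV :: 'a set))"
  unfolding weak_dunford_pettis_def
proof (intro allI impI, elim conjE)
  fix F :: "'f normed_struct" and T :: "'a \<Rightarrow> 'f" and x :: "nat \<Rightarrow> 'a"
  assume F: "banach_space F" and T: "weakly_compact_operator (sublattice UNIV) F T"
    and x: "weakly_null (sublattice UNIV) x"
    and disj: "\<forall>m n. m \<noteq> n \<longrightarrow> disjoint_vectors (sublattice UNIV) (x m) (x n)"
  interpret F: banach_struct F by unfold_locales (rule F)
  have I: "ideal I" using assms(1) by (auto simp: closed_ideal_def ideal_def)
  have Tb: "bounded_linear_map (sublattice UNIV) F T"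
    using T by (simp add: weakly_compact_operator_def)
  have T_car: "T z \<in> F.car" and T_add: "T (z + w) = vadd F (T z) (T w)" for z w
    using Tb by (auto simp: bounded_linear_map_def)
  obtain C where C: "\<And>z. F.nrm (T z) \<le> C * norm z"
    using Tb by (auto simp: bounded_linear_map_def)
  have xdisj: "inf \<bar>x m\<bar> \<bar>x n\<bar> = 0" if "m \<noteq> n" for m n
    using disj that by (simp add: disjoint_vectors_sublattice[OF ideal_UNIV])
  have "(\<lambda>n. F.nrm (T (x n))) \<longlonglongrightarrow> 0"
  \<comment> \<open>A unit vector is required to build the space of sequences; without one the
    lattice is zero and so is \<open>T\<close>.\<close>
  proof (cases "\<exists>e::'a. norm e = 1")
    case False
    have "x n = 0" for n
      using False norm_sgn[of "x n"] by metis
    then have "F.nrm (T (x n)) = 0" for n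
      using C[of 0] F.norm_nonneg[OF T_car, of 0] by simp
    then show ?thesis by simp
  next
    case True
    then obtain e :: 'a where e: "norm e = 1" by blast
    obtain y where yI: "range y \<subseteq> I" and y_le: "\<And>n. \<bar>y n\<bar> \<le> \<bar>x n\<bar>"
      and xy: "(\<lambda>n. norm (x n - y n)) \<longlonglongrightarrow> 0"
      using ex_ideal_approximation_of_disjoint[OF I assms(3) x xdisj] by blast
    \<comment> \<open>Weak nullity is meant with respect to all functionals on
      \<open>I\<close>.\<close>
    have y: "weakly_null (sublattice I) y"
      by (rule weakly_null_of_dominated_disjoint[OF I yI x xdisj y_le])
    have ydisj: "disjoint_vectors (sublattice I) (y m) (y n)" if "m \<noteq> n" for m n
    proof -
      have "inf \<bar>y m\<bar> \<bar>y n\<bar> \<le> inf \<bar>x m\<bar> \<bar>x n\<bar>" by (rule inf_mono[OF y_le y_le])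
      then have "inf \<bar>y m\<bar> \<bar>y n\<bar> = 0" using xdisj[OF that] by (intro antisym) auto
      then show ?thesis using yI by (simp add: disjoint_vectors_sublattice[OF I] range_subsetD)
    qed
    have "range (\<lambda>n. T (y n)) \<subseteq> F.car" using T_car by blast
    \<comment> \<open>The hypothesis on \<open>I\<close> concerns codomains in
      \<open>nat \<Rightarrow> 'a\<close>, while \<open>F\<close> lives in \<open>'f\<close>;
      \<open>S\<close> changes the codomain without making the norms of \<open>T (y n)\<close>
      smaller.\<close>
    then obtain G :: "(nat \<Rightarrow> 'a) normed_struct" and S where G: "banach_space G"
      and S: "bounded_linear_map F G S" and S_norm: "\<And>n. F.nrm (T (y n)) \<le> vnorm G (S (T (y n)))"
      using ex_norming_operator[OF F _ e] by metis
    have "weakly_compact_operator (sublattice I) G (S \<circ> T)"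
      by (rule weakly_compact_operator_compose[OF weakly_compact_operator_restrict[OF T] S F G]) simp
    then have "norm_null G (\<lambda>n. (S \<circ> T) (y n))"
      using assms(2) G y ydisj unfolding weak_dunford_pettis_def by blast
    then have "(\<lambda>n. vnorm G (S (T (y n)))) \<longlonglongrightarrow> 0"
      by (simp add: norm_null_def)
    then have lim: "(\<lambda>n. vnorm G (S (T (y n))) + C * norm (x n - y n)) \<longlonglongrightarrow> 0"
      using tendsto_add[OF _ tendsto_mult_left[OF xy, of C]] by fastforce
    have "F.nrm (T (x n)) \<le> vnorm G (S (T (y n))) + C * norm (x n - y n)" for n
    proof -
      have "F.nrm (T (x n)) = F.nrm (vadd F (T (y n)) (T (x n - y n)))"
        using T_add[of "y n" "x n - y n"] by simp
      also have "\<dots> \<le> F.nrm (T (y n)) + F.nrm (T (x n - y n))"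
        by (intro F.norm_triangle T_car)
      also have "\<dots> \<le> vnorm G (S (T (y n))) + C * norm (x n - y n)"
        by (intro add_mono S_norm C)
      finally show ?thesis .
    qed
    then have "norm (F.nrm (T (x n))) \<le> vnorm G (S (T (y n))) + C * norm (x n - y n)" for n
      using F.norm_nonneg[OF T_car, of "x n"] by (simp only: real_norm_def abs_of_nonneg)
    then show ?thesis
      by (intro Lim_null_comparison[OF _ lim] always_eventually allI)
  qed
  then show "norm_null F (\<lambda>n. T (x n))"
    using T_car by (auto simp: norm_null_def)
qed

end
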